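(* Let $0<\gamma\le\infty$, $I=[0,\gamma)$, let $w$ be a weight function on $I$, with $W(\infty)=\infty$ if $\gamma=\infty$, and let $\varphi$ be an Orlicz $N$-function. Suppose that $\varphi$ satisfies the $\Delta_2$ condition if $\gamma=\infty$, or that $\varphi$ satisfies the $\Delta_2^\infty$ condition if $\gamma<\infty$. Then there are nonempty relatively weakly open subsets of the unit ball $B_{\Lambda_{\varphi,w}}$ of the Orlicz-Lorentz space $\Lambda_{\varphi,w}$ with arbitrarily small diameter.
   Context: Decreasing means non-increasing. $L^0=L^0(I)$ is the set of all (classes of a.e. equal) Lebesgue measurable functions $x:I\to\mathbb{R}$; $m$ is Lebesgue measure. For $x\in L^0$, $d_x(\lambda)=m\{t\in I:|x(t)|>\lambda\}$, $\lambda\ge 0$, and $x^*(t)=\inf\{\lambda\ge 0: d_x(\lambda)\le t\}$, $t\ge 0$, is the decreasing rearrangement (values in $[0,\infty]$, $\inf\emptyset=\infty$). A weight function is a decreasing function $w:I\to(0,\infty)$ that is locally integrable: $W(t)=\int_0^t w<\infty$ for all $t\in I$; if $\gamma=\infty$, $W(\infty)=\int_0^\infty w$. An Orlicz function is a convex $\varphi:[0,\infty)\to[0,\infty)$ with $\varphi(0)=0$ and $\varphi(u)>0$ for $u>0$ (and $\varphi(\infty)=\infty$). It is an Orlicz $N$-function if moreover $\lim_{u\to 0^+}\varphi(u)/u=0$ and $\lim_{u\to\infty}\varphi(u)/u=\infty$. $\varphi$ satisfies $\Delta_2$ if there is $K>0$ with $\varphi(2u)\le K\varphi(u)$ for all $u\ge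 0$; it satisfies $\Delta_2^\infty$ if there are $K>0$, $u_0\ge 0$ with $\varphi(2u)\le K\varphi(u)$ for all $u\ge u_0$. For $x\in L^0$ let $\rho(x)=\int_0^\gamma\varphi(x^*(t))w(t)\,dt$. The Orlicz-Lorentz space is $\Lambda_{\varphi,w}=\{x\in L^0:\rho(\lambda x)<\infty\text{ for some }\lambda>0\}$, a real Banach space with the Luxemburg norm $\|x\|=\inf\{\epsilon>0:\rho(x/\epsilon)\le 1\}$. $B_{\Lambda_{\varphi,w}}$ is its closed unit ball; a relatively weakly open subset of it is its intersection with a weakly open subset of the space; diameter is taken in the Luxemburg norm. *)

theory Defs
  imports "HOL-Analysis.Analysis"
begin

section \<open>Classes of Lebesgue measurable functions\<close>

quotient_type lebfun = "real \<Rightarrow> real" / partial: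
  "\<lambda>x y. x \<in> borel_measurable lebesgue \<and> y \<in> borel_measurable lebesgue \<and>
         (AE t in lebesgue. x t = y t)"
proof (rule part_equivpI)
  show "\<exists>x::real \<Rightarrow> real. x \<in> borel_measurable lebesgue \<and> x \<in> borel_measurable lebesgue \<and>
      (AE t in lebesgue. x t = x t)"
    by (rule exI[of _ "\<lambda>_. 0"]) simp
  show "symp (\<lambda>x y. x \<in> borel_measurable lebesgue \<and> y \<in> borel_measurable lebesgue \<and>
      (AE t in lebesgue. x t = (y t :: real)))"
    by (rule sympI) (auto elim: eventually_mono)
  show "transp (\<lambda>x y. x \<in> borel_measurable lebesgue \<and> y \<in> borel_measurable lebesgue \<and>
      (AE t in lebesgue. x t = (y t :: real)))"
    by (rule transpI) (auto elim: eventually_elim2)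
qed

instantiation lebfun :: real_vector
begin

lift_definition zero_lebfun :: lebfun is "\<lambda>_. 0"
  by simp

lift_definition plus_lebfun :: "lebfun \<Rightarrow> lebfun \<Rightarrow> lebfun" is "\<lambda>x y t. x t + y t"
  by (auto elim: eventually_elim2)

lift_definition uminus_lebfun :: "lebfun \<Rightarrow> lebfun" is "\<lambda>x t. - x t"
  by auto

lift_definition minus_lebfun :: "lebfun \<Rightarrow> lebfun \<Rightarrow> lebfun" is "\<lambda>x y t. x t - y t"
  by (auto elim: eventually_elim2)

lift_definition scaleR_lebfun :: "real \<Rightarrow> lebfun \<Rightarrow> lebfun" is "\<lambda>c x t. c * x t"
  by (auto elim: eventually_mono)

instance
  by standard (transfer; auto simp: algebra_simps)+

end

definition interval :: "ereal \<Rightarrow> real set" where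
  "interval \<gamma> = {t. 0 \<le> t \<and> ereal t < \<gamma>}"

text \<open>\<open>L\<^sup>0(I)\<close> for \<open>I = [0,\<gamma>)\<close>: a class of functions on \<open>I\<close> is identified with the class
  of their extensions by zero to the real line.\<close>

lift_definition vanishes_off :: "real set \<Rightarrow> lebfun \<Rightarrow> bool" is
  "\<lambda>I x. AE t in lebesgue. t \<notin> I \<longrightarrow> x t = 0"
  by (auto elim: eventually_elim2)

definition L0 :: "ereal \<Rightarrow> lebfun set" where
  "L0 \<gamma> = {x. vanishes_off (interval \<gamma>) x}"

lift_definition distr_fun :: "ereal \<Rightarrow> lebfun \<Rightarrow> real \<Rightarrow> ennreal" is
  "\<lambda>\<gamma> x r. emeasure lebesgue {t \<in> interval \<gamma>. \<bar>x t\<bar> > r}"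
proof (rule ext)
  fix \<gamma> :: ereal and x y :: "real \<Rightarrow> real" and r :: real
  assume *: "x \<in> borel_measurable lebesgue \<and> y \<in> borel_measurable lebesgue \<and>
    (AE t in lebesgue. x t = y t)"
  have [measurable]: "x \<in> borel_measurable lebesgue" "y \<in> borel_measurable lebesgue"
    using * by auto
  have "interval \<gamma> = {0..} \<inter> ereal -` {..<\<gamma>}"
    by (auto simp: interval_def)
  also have "\<dots> \<in> sets borel"
    by (intro sets.Int borel_closed borel_open open_vimage)
      (auto simp: continuous_on_ereal)
  finally have I: "interval \<gamma> \<in> sets lebesgue"
    by (simp add: sets_completionI_sets)
  have "{t \<in> interval \<gamma>. \<bar>z t\<bar> > r} \<in> sets lebesgue"
    if [measurable]: "z \<in> borel_measurable lebesgue" for z :: "real \<Rightarrow> real"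
  proof -
    have "{t \<in> space lebesgue. \<bar>z t\<bar> > r} \<in> sets lebesgue"
      by measurable
    from sets.Int[OF I this] show ?thesis
      by (simp add: Int_def)
  qed
  then show "emeasure lebesgue {t \<in> interval \<gamma>. \<bar>x t\<bar> > r} =
        emeasure lebesgue {t \<in> interval \<gamma>. \<bar>y t\<bar> > r}"
    using * by (intro emeasure_eq_AE) (auto elim: eventually_mono)
qed

definition decr_rearr :: "ereal \<Rightarrow> lebfun \<Rightarrow> real \<Rightarrow> ennreal" where
  "decr_rearr \<gamma> x t = Inf {ennreal r | r. 0 \<le> r \<and> distr_fun \<gamma> x r \<le> ennreal t}"


section \<open>Weights and Orlicz functions\<close>

text \<open>Positivity and monotonicity are required on the open interval \<open>(0,\<gamma>)\<close> only, so that weights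
  which are unbounded at \<open>0\<close>, such as \<open>t powr (-1/2)\<close>, are included; the value at \<open>0\<close> is
  irrelevant.\<close>

definition weight :: "ereal \<Rightarrow> (real \<Rightarrow> real) \<Rightarrow> bool" where
  "weight \<gamma> w \<longleftrightarrow>
     (\<forall>t. 0 < t \<and> ereal t < \<gamma> \<longrightarrow> w t > 0) \<and>
     (\<forall>s t. 0 < s \<and> s \<le> t \<and> ereal t < \<gamma> \<longrightarrow> w t \<le> w s) \<and>
     (\<forall>t \<in> interval \<gamma>. (\<integral>\<^sup>+ s \<in> {0..t}. ennreal (w s) \<partial>lebesgue) < \<infinity>)"

definition orlicz_fun :: "(real \<Rightarrow> real) \<Rightarrow> bool" where
  "orlicz_fun \<phi> \<longleftrightarrow> convex_on {0..} \<phi> \<and> \<phi> 0 = 0 \<and> (\<forall>u>0. \<phi> u > 0)"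

definition orlicz_N_fun :: "(real \<Rightarrow> real) \<Rightarrow> bool" where
  "orlicz_N_fun \<phi> \<longleftrightarrow> orlicz_fun \<phi> \<and>
     ((\<lambda>u. \<phi> u / u) \<longlongrightarrow> 0) (at_right 0) \<and>
     filterlim (\<lambda>u. \<phi> u / u) at_top at_top"

definition Delta2 :: "(real \<Rightarrow> real) \<Rightarrow> bool" where
  "Delta2 \<phi> \<longleftrightarrow> (\<exists>K>0. \<forall>u\<ge>0. \<phi> (2 * u) \<le> K * \<phi> u)"

definition Delta2_infty :: "(real \<Rightarrow> real) \<Rightarrow> bool" where
  "Delta2_infty \<phi> \<longleftrightarrow> (\<exists>K>0. \<exists>u\<^sub>0\<ge>0. \<forall>u\<ge>u\<^sub>0. \<phi> (2 * u) \<le> K * \<phi> u)"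

definition orlicz_ext :: "(real \<Rightarrow> real) \<Rightarrow> ennreal \<Rightarrow> ennreal" where
  "orlicz_ext \<phi> v = (if v = \<infinity> then \<infinity> else ennreal (\<phi> (enn2real v)))"


section \<open>Orlicz-Lorentz spaces\<close>

definition OL_modular :: "ereal \<Rightarrow> (real \<Rightarrow> real) \<Rightarrow> (real \<Rightarrow> real) \<Rightarrow> lebfun \<Rightarrow> ennreal" where
  "OL_modular \<gamma> \<phi> w x =
     (\<integral>\<^sup>+ t \<in> interval \<gamma>. orlicz_ext \<phi> (decr_rearr \<gamma> x t) * ennreal (w t) \<partial>lebesgue)"

definition OL_space :: "ereal \<Rightarrow> (real \<Rightarrow> real) \<Rightarrow> (real \<Rightarrow> real) \<Rightarrow> lebfun set" where
  "OL_space \<gamma> \<phi> w = {x \<in> L0 \<gamma>. \<exists>r>0. OL_modular \<gamma> \<phi> w (r *\<^sub>R x) < \<infinity>}"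

definition OL_norm :: "ereal \<Rightarrow> (real \<Rightarrow> real) \<Rightarrow> (real \<Rightarrow> real) \<Rightarrow> lebfun \<Rightarrow> real" where
  "OL_norm \<gamma> \<phi> w x = Inf {\<epsilon>. \<epsilon> > 0 \<and> OL_modular \<gamma> \<phi> w (x /\<^sub>R \<epsilon>) \<le> 1}"

definition OL_ball :: "ereal \<Rightarrow> (real \<Rightarrow> real) \<Rightarrow> (real \<Rightarrow> real) \<Rightarrow> lebfun set" where
  "OL_ball \<gamma> \<phi> w = {x \<in> OL_space \<gamma> \<phi> w. OL_norm \<gamma> \<phi> w x \<le> 1}"


section \<open>Weak topology and diameter for a norm on a subspace of a vector space\<close>

text \<open>Bounded linear functionals on the normed space \<open>(S, N)\<close>; values outside \<open>S\<close> are
  unconstrained.\<close>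

definition dual_on :: "'a::real_vector set \<Rightarrow> ('a \<Rightarrow> real) \<Rightarrow> ('a \<Rightarrow> real) set" where
  "dual_on S N = {f. (\<forall>x\<in>S. \<forall>y\<in>S. f (x + y) = f x + f y) \<and>
                     (\<forall>c. \<forall>x\<in>S. f (c *\<^sub>R x) = c * f x) \<and>
                     (\<exists>C. \<forall>x\<in>S. \<bar>f x\<bar> \<le> C * N x)}"

definition weak_topology_on :: "'a::real_vector set \<Rightarrow> ('a \<Rightarrow> real) \<Rightarrow> 'a topology" where
  "weak_topology_on S N =
     topology_generated_by {{x \<in> S. f x \<in> V} | f V. f \<in> dual_on S N \<and> open V}"

definition norm_diam :: "('a::real_vector \<Rightarrow> real) \<Rightarrow> 'a set \<Rightarrow> ereal" where
  "norm_diam N A = (SUP (x, y) \<in> A \<times> A. ereal (N (x - y)))"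

end

theory Submission
  imports Defs
begin

text \<open>By the layer-cake formula \<open>\<rho>(y) = \<integral> W(d\<^sub>y(l)) \<phi>'(l) dl\<close>. Since \<open>\<phi>\<close> is an \<open>N\<close>-function, its
  graph has exposed points \<open>(u, \<phi> u)\<close> with \<open>u\<close> arbitrarily large, say with supporting slope \<open>p\<close>;
  choose \<open>a\<close> with \<open>W(a) \<phi>(u) = 1\<close>. Then \<open>x = u \<chi>\<^bsub>(0,a)\<^esub>\<close> is normed by \<open>f y = p \<integral>\<^sub>0\<^sup>a y w\<close>, and
  it suffices to shrink a single slice defined by \<open>f\<close>.
  Indeed, for \<open>\<rho>(y) \<le> 1\<close> the defect \<open>f x - f y\<close> dominates the integral over all levels \<open>l\<close> of
  nonnegative terms that measure how far the level sets \<open>{y > l}\<close> are from \<open>(0,a)\<close> for \<open>l < u\<close> and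
  from the empty set for \<open>l > u\<close>. Hence a small defect forces \<open>y\<close> to be close to \<open>x\<close> in measure and
  its tail to be small in modular, and the \<open>\<Delta>\<^sub>2\<close> condition turns this into closeness in norm.\<close>

section \<open>The right derivative of an Orlicz function\<close>

text \<open>The rearrangement enters only through the equivalence of \<open>l < x^*(t)\<close> and
  \<open>t < d_x(l)\<close>; after Fubini every quantity is an integral over the level
  \<open>l\<close>, where \<open>psi\<close> is the right derivative of \<phi>. The slope
  \<open>p\<close> is taken outside the countable set of values that \<open>psi\<close> keeps on a
  whole interval. This makes \<open>psi - p\<close> change sign strictly at \<open>u\<close>;
  otherwise the defect could vanish on an interval of levels and say nothing about them. Superlinear
  growth is what makes \<open>psi\<close> cross every such \<open>p\<close>, and \<open>u\<close>
  must be large because \<open>W\<close> may be bounded while \<open>W(a) = 1 / \<phi>(u)\<close>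
  has to be solved inside the interval. The factors in the defect degenerate near the levels 0 and
  \<open>u\<close>, so closeness to the center is obtained at a fixed distance \<open>d\<close>
  only. What is left below level \<open>d\<close> is absorbed by the finite total weight or by
  doubling near 0, and the high levels by the tail estimate. Convexity of the modular is never
  invoked: subadditivity of \<open>W\<close> gives a triangle inequality with a factor 2, which
  suffices.\<close>

locale orlicz =
  fixes \<phi> :: "real \<Rightarrow> real"
  assumes orlicz: "orlicz_fun \<phi>"
begin

lemma phi_convex: "convex_on {0..} \<phi>" and phi_0 [simp]: "\<phi> 0 = 0"
  and phi_pos: "u > 0 \<Longrightarrow> \<phi> u > 0"
  using orlicz by (auto simp: orlicz_fun_def)

lemma phi_nonneg: "u \<ge> 0 \<Longrightarrow> \<phi> u \<ge> 0"
  using phi_pos[of u] by (cases "u = 0") auto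

definition slope :: "real \<Rightarrow> real \<Rightarrow> real" where
  "slope s t = (\<phi> t - \<phi> s) / (t - s)"

lemma slope_mono:
  assumes "0 \<le> r" "r < s" "s < t"
  shows "slope r s \<le> slope r t" "slope r t \<le> slope s t"
proof -
  have swap: "(\<phi> x - \<phi> y) / (x - y) = slope x y" for x y
    by (metis minus_diff_eq minus_divide_divide slope_def)
  show "slope r s \<le> slope r t" "slope r t \<le> slope s t"
    using convex_on_slope_le[OF phi_convex, of r t s] assms by (auto simp: swap)
qed

lemma slope_pos:
  assumes "0 \<le> s" "s < t"
  shows "slope s t > 0"
proof (cases "s = 0")
  case True
  then show ?thesis
    using assms phi_pos[of t] by (simp add: slope_def)
next
  case False
  then have "slope 0 s \<le> slope s t" "slope 0 s > 0"
    using slope_mono[of 0 s t] phi_pos[of s] assms by (auto simp: slope_def)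
  then show ?thesis by linarith
qed

text \<open>The right derivative on \<open>(0,\<infinity>)\<close>; extending it by 0 makes it monotone on the whole line.\<close>

definition psi :: "real \<Rightarrow> real" where
  "psi s = (if s \<le> 0 then 0 else Inf (slope s ` {s<..}))"

lemma bdd_below_slope: "0 \<le> s \<Longrightarrow> bdd_below (slope s ` {s<..})"
  using slope_pos by (intro bdd_belowI[of _ 0]) (auto intro: less_imp_le)

lemma psi_le_slope: "0 \<le> s \<Longrightarrow> s < t \<Longrightarrow> psi s \<le> slope s t"
  using slope_pos[of s t] bdd_below_slope[of s]
  by (auto simp: psi_def intro!: cInf_lower)

lemma slope_le_psi: "0 \<le> s \<Longrightarrow> s < t \<Longrightarrow> slope s t \<le> psi t"
  by (auto simp: psi_def intro!: cInf_greatest intro: order_trans[OF slope_mono(1) slope_mono(2)])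

lemma psi_nonpos [simp]: "s \<le> 0 \<Longrightarrow> psi s = 0"
  by (simp add: psi_def)

lemma phi_over_le_psi: "0 < t \<Longrightarrow> \<phi> t / t \<le> psi t"
  using slope_le_psi[of 0 t] by (simp add: slope_def)

lemma psi_pos: "0 < t \<Longrightarrow> 0 < psi t"
  using phi_over_le_psi[of t] phi_pos[of t] by (smt (verit) divide_pos_pos)

lemma psi_nonneg [simp]: "0 \<le> psi t"
  using psi_pos[of t] by (cases "t \<le> 0") auto

lemma psi_mono: "s \<le> t \<Longrightarrow> psi s \<le> psi t"
  using psi_le_slope[of s t] slope_le_psi[of s t] psi_nonneg[of t] psi_nonpos[of s]
  by (smt (verit))

lemma mono_psi: "mono psi"
  by (simp add: mono_def psi_mono)

lemma measurable_psi [measurable]: "psi \<in> borel_measurable borel"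
  by (rule borel_measurable_mono[OF mono_psi])

lemma psi_diff_bounds:
  assumes "0 \<le> s" "s \<le> t"
  shows "psi s * (t - s) \<le> \<phi> t - \<phi> s" "\<phi> t - \<phi> s \<le> psi t * (t - s)"
  using psi_le_slope[of s t] slope_le_psi[of s t] assms
  by (cases "s = t"; simp add: slope_def field_simps)+

lemma psi_integrable: "psi integrable_on {s..t}"
  using integrable_on_mono_on[of s t psi] mono_psi by (simp add: mono_on_def psi_mono)

lemma psi_le_phi_double: "0 < t \<Longrightarrow> psi t \<le> \<phi> (2 * t) / t"
  using psi_diff_bounds(1)[of t "2 * t"] phi_nonneg[of t] by (simp add: field_simps)

lemma phi_mono: "0 \<le> s \<Longrightarrow> s \<le> t \<Longrightarrow> \<phi> s \<le> \<phi> t"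
  using psi_diff_bounds(1)[of s t] by (smt (verit) psi_nonneg mult_nonneg_nonneg)

text \<open>\<open>psi\<close> may jump, so \<phi> need not be differentiable. On a cell from
  \<open>a\<close> to \<open>b\<close> the increments of \<phi> and of the integral both lie between
  \<open>psi a * (b - a)\<close> and \<open>psi b * (b - a)\<close>. Over \<open>Suc n\<close> equal
  cells the errors telescope to \<open>(psi t - psi s) * (t - s) / Suc n\<close>, which tends to
  0.\<close>

lemma integral_psi:
  assumes "0 \<le> s" "s \<le> t"
  shows "integral {s..t} psi = \<phi> t - \<phi> s"
proof -
  define F where "F x = integral {s..x} psi - \<phi> x" for x
  have step: "\<bar>F b - F a\<bar> \<le> (psi b - psi a) * (b - a)" if "s \<le> a" "a \<le> b" for a b
  proof -
    have "integral {s..a} psi + integral {a..b} psi = integral {s..b} psi"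
      using that by (intro Henstock_Kurzweil_Integration.integral_combine psi_integrable) auto
    moreover have "integral {a..b} psi \<le> integral {a..b} (\<lambda>_. psi b)"
      by (intro integral_le psi_integrable) (auto intro: psi_mono)
    moreover have "integral {a..b} psi \<ge> integral {a..b} (\<lambda>_. psi a)"
      by (intro integral_le psi_integrable) (auto intro: psi_mono)
    ultimately show ?thesis
      using psi_diff_bounds[of a b] that assms
      by (auto simp: F_def abs_le_iff algebra_simps)
  qed
  have bound: "\<bar>F t - F s\<bar> \<le> (psi t - psi s) * (t - s) / Suc n" for n
  proof -
    define c where "c = (t - s) / Suc n"
    define p where "p i = s + real i * c" for i
    have p: "p (Suc i) - p i = c" for i
      unfolding p_def by (simp add: algebra_simps)
    have c: "0 \<le> c" "real (Suc n) * c = t - s"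
      using assms by (auto simp: c_def)
    have "\<bar>\<Sum>i<Suc n. F (p (Suc i)) - F (p i)\<bar> \<le> (\<Sum>i<Suc n. \<bar>F (p (Suc i)) - F (p i)\<bar>)"
      by (rule sum_abs)
    also have "\<dots> \<le> (\<Sum>i<Suc n. (psi (p (Suc i)) - psi (p i)) * (p (Suc i) - p i))"
    proof (intro sum_mono step)
      fix i
      show "s \<le> p i" unfolding p_def using c by auto
      show "p i \<le> p (Suc i)" using p[of i] c by linarith
    qed
    also have "\<dots> = (\<Sum>i<Suc n. psi (p (Suc i)) - psi (p i)) * c"
      unfolding p sum_distrib_right ..
    also have "\<dots> = (psi (p (Suc n)) - psi (p 0)) * c"
      by (simp only: sum_lessThan_telescope[of "\<lambda>i. psi (p i)"])
    also have "(\<Sum>i<Suc n. F (p (Suc i)) - F (p i)) = F (p (Suc n)) - F (p 0)"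
      by (rule sum_lessThan_telescope)
    also have "p (Suc n) = t" unfolding p_def c(2) by simp
    also have "p 0 = s" by (simp add: p_def)
    finally show ?thesis by (simp add: c_def)
  qed
  have "(\<lambda>n. (psi t - psi s) * (t - s) / Suc n) \<longlonglongrightarrow> 0"
    using tendsto_mult_right_zero[OF LIMSEQ_inverse_real_of_nat, of "(psi t - psi s) * (t - s)"]
    by (simp add: divide_inverse)
  then have "\<bar>F t - F s\<bar> \<le> 0"
    by (rule LIMSEQ_le_const) (use bound in auto)
  then show ?thesis by (simp add: F_def)
qed

section \<open>Layer-cake integrals of the right derivative\<close>

abbreviation Psi :: "real \<Rightarrow> ennreal" where "Psi \<equiv> \<lambda>l. ennreal (psi l)"

lemma nn_integral_psi:
  assumes "0 \<le> s" "s \<le> t"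
  shows "(\<integral>\<^sup>+l. Psi l * indicator {s..t} l \<partial>lborel) = ennreal (\<phi> t - \<phi> s)"
proof -
  have "(psi has_integral (\<phi> t - \<phi> s)) {s..t}"
    using integral_psi[OF assms] psi_integrable[of s t] by (metis integrable_integral)
  then show ?thesis
    by (intro nn_integral_has_integral_lebesgue') auto
qed

lemma nn_integral_psi_lessThan:
  assumes "0 \<le> t"
  shows "(\<integral>\<^sup>+l. Psi l * indicator {..<t} l \<partial>lborel) = ennreal (\<phi> t)"
proof -
  have "(\<integral>\<^sup>+l. Psi l * indicator {..<t} l \<partial>lborel) = (\<integral>\<^sup>+l. Psi l * indicator {0..t} l \<partial>lborel)"
  proof (rule nn_integral_cong_AE)
    show "AE l in lborel. Psi l * indicator {..<t} l = Psi l * indicator {0..t} l"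
      using AE_lborel_singleton[of t]
    proof eventually_elim
      case (elim l)
      then show ?case by (cases "l < 0") (auto simp: indicator_def)
    qed
  qed
  then show ?thesis using nn_integral_psi[of 0 t] assms by simp
qed

lemma nn_integral_psi_UNIV: "(\<integral>\<^sup>+l. Psi l \<partial>lborel) = \<infinity>"
proof -
  have "ennreal (of_nat n) \<le> (\<integral>\<^sup>+l. Psi l \<partial>lborel)" for n
  proof -
    \<comment> \<open>The point where the supporting line of \<phi> at 1, of slope
      \<open>psi 1\<close>, has risen by \<open>n\<close>.\<close>
    define t where "t = 1 + n / psi 1"
    have "psi 1 > 0" using psi_pos[of 1] by simp
    then have t: "t \<ge> 1" "psi 1 * (t - 1) = n" by (auto simp: t_def)
    then have "real n \<le> \<phi> t" using psi_diff_bounds(1)[of 1 t] phi_nonneg[of 1] by simp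
    then have "ennreal n \<le> ennreal (\<phi> t)" by (rule ennreal_leI)
    also have "\<dots> = (\<integral>\<^sup>+l. Psi l * indicator {..<t} l \<partial>lborel)"
      using nn_integral_psi_lessThan[of t] t by simp
    also have "\<dots> \<le> (\<integral>\<^sup>+l. Psi l \<partial>lborel)"
      by (intro nn_integral_mono) (auto simp: indicator_def)
    finally show ?thesis .
  qed
  then show ?thesis
    by (metis ennreal_Ex_less_of_nat ennreal_of_nat_eq_real_of_nat infinity_ennreal_def leD top.not_eq_extremum)
qed

text \<open>Layer cake for a single value, infinity included, where the integral diverges. Negative
  levels, which \<open>ennreal\<close> sends to 0, do no harm because \<open>psi\<close> vanishes
  there.\<close>

lemma orlicz_ext_eq_nn_integral:
  "orlicz_ext \<phi> v = (\<integral>\<^sup>+l. Psi l * indicator {l. ennreal l < v} l \<partial>lborel)"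
proof (cases v)
  case (real r)
  have "(\<integral>\<^sup>+l. Psi l * indicator {l. ennreal l < v} l \<partial>lborel) =
      (\<integral>\<^sup>+l. Psi l * indicator {..<r} l \<partial>lborel)"
  proof (intro nn_integral_cong)
    fix l
    show "Psi l * indicator {l. ennreal l < v} l = Psi l * indicator {..<r} l"
      using real by (cases "l \<le> 0") (auto simp: indicator_def ennreal_less_iff)
  qed
  then show ?thesis
    using real nn_integral_psi_lessThan by (simp add: orlicz_ext_def)
next
  case top
  then show ?thesis
    using nn_integral_psi_UNIV by (simp add: orlicz_ext_def)
qed

text \<open>A value that \<open>psi\<close> takes twice is, by monotonicity, its value at some
  rational, so such values are countable and some \<open>p\<close> just above
  \<open>psi (M' + 1)\<close> avoids them. The crossing level \<open>u\<close> is finite because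
  \<open>psi\<close> dominates \<open>\<phi> u / u\<close>, which eventually reaches
  \<open>p\<close>.\<close>

lemma exposed_point_exists:
  assumes lim: "filterlim (\<lambda>u. \<phi> u / u) at_top at_top"
  obtains u p where "M < u" "0 < u" "0 < p" "\<And>l. l < u \<Longrightarrow> psi l < p" "\<And>l. u < l \<Longrightarrow> p < psi l"
proof -
  define M' where "M' = max M 1"
  define bad where "bad = {p. \<exists>s t. s < t \<and> psi s = p \<and> psi t = p}"
  have "countable bad"
  proof -
    have "\<forall>p\<in>bad. \<exists>q::rat. psi (of_rat q) = p"
    proof
      fix p assume "p \<in> bad"
      then obtain s t where st: "s < t" "psi s = p" "psi t = p" by (auto simp: bad_def)
      obtain q where "s < of_rat q" "of_rat q < t" using of_rat_dense[OF st(1)] by auto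
      then show "\<exists>q::rat. psi (of_rat q) = p"
        using psi_mono[of s "of_rat q"] psi_mono[of "of_rat q" t] st by (intro exI[of _ q]) auto
    qed
    then have "bad \<subseteq> range (\<lambda>q::rat. psi (of_rat q))" by force
    then show ?thesis by (rule countable_subset) auto
  qed
  then have "\<not> {psi (M' + 1) <..< psi (M' + 1) + 1} \<subseteq> bad"
    using countable_subset uncountable_open_interval by (metis less_add_one)
  then obtain p where p: "psi (M' + 1) < p" "p \<notin> bad"
    by (metis greaterThanLessThan_iff subsetI)
  define S where "S = {l. psi l < p}"
  from lim obtain N where N: "\<And>u. u \<ge> N \<Longrightarrow> p \<le> \<phi> u / u"
    unfolding filterlim_at_top eventually_at_top_linorder by blast
  have bdd: "bdd_above S"
  proof (rule bdd_aboveI)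
    fix l assume "l \<in> S"
    show "l \<le> max N 1"
    proof (rule ccontr)
      assume "\<not> l \<le> max N 1"
      then have "p \<le> psi l" using N[of l] phi_over_le_psi[of l] by (smt (verit))
      with \<open>l \<in> S\<close> show False by (auto simp: S_def)
    qed
  qed
  have M: "M' + 1 \<in> S" using p by (simp add: S_def)
  define u where "u = Sup S"
  have Mu: "M' + 1 \<le> u" unfolding u_def using M bdd by (rule cSup_upper)
  have below: "psi l < p" if "l < u" for l
  proof -
    from that M obtain l' where "l' \<in> S" "l < l'" unfolding u_def using less_cSup_iff[OF _ bdd] by auto
    then show ?thesis using psi_mono[of l l'] by (auto simp: S_def)
  qed
  have above: "p < psi l" if ul: "u < l" for l
  proof -
    have *: "p \<le> psi l'" if "u < l'" for l'
      using cSup_upper[OF _ bdd, of l'] that unfolding u_def S_def mem_Collect_eq by linarith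
    obtain l' where "u < l'" "l' < l" using dense[OF ul] by blast
    \<comment> \<open>Equality would force \<open>psi = p\<close> at \<open>l'\<close> as well, and
      \<open>p\<close> would be a repeated value.\<close>
    have "psi l \<noteq> p"
    proof
      assume "psi l = p"
      then have "psi l' = p" using *[OF \<open>u < l'\<close>] psi_mono[of l' l] \<open>l' < l\<close> by simp
      with \<open>psi l = p\<close> \<open>l' < l\<close> p(2) show False unfolding bad_def by blast
    qed
    with *[OF ul] show ?thesis by auto
  qed
  have "0 < p" using p psi_nonneg[of "M' + 1"] by linarith
  moreover have "M < u" "0 < u" using Mu by (auto simp: M'_def)
  ultimately show ?thesis using that below above by blast
qed

end

section \<open>The weighted measure\<close>

text \<open>Superlevel sets of a decreasing function are intervals.\<close>

lemma antimono_borel_measurable_ennreal: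
  fixes f :: "real \<Rightarrow> ennreal"
  assumes "antimono f"
  shows "f \<in> borel_measurable borel"
proof (rule borel_measurableI_greater)
  fix c
  have "is_interval {x. c < f x}"
    unfolding is_interval_1 using assms by (auto simp: antimono_def intro: less_le_trans)
  then have "{x. c < f x} \<in> sets borel"
    using real_interval_borel_measurable by blast
  then show "{x \<in> space borel. c < f x} \<in> sets borel" by simp
qed

lemma interval_borel [measurable]: "interval \<gamma> \<in> sets borel"
proof -
  have "{t \<in> space borel. 0 \<le> t \<and> ereal t < \<gamma>} \<in> sets borel" by measurable
  then show ?thesis by (simp add: interval_def)
qed

locale weighted =
  fixes \<gamma> :: ereal and w :: "real \<Rightarrow> real"
  assumes \<gamma>_pos: "0 < \<gamma>" and weight: "weight \<gamma> w"
begin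

text \<open>The endpoint 0 is dropped: \<open>weight\<close> says nothing about \<open>w 0\<close>,
  and a single point is null.\<close>

definition P :: "real set" where "P = {t. 0 < t \<and> ereal t < \<gamma>}"

definition om :: "real \<Rightarrow> ennreal" where "om t = ennreal (w t) * indicator P t"

definition nu :: "real measure" where "nu = density lborel om"

text \<open>The primitive of the weight, extended to infinite arguments because distribution
  functions can be infinite. For \<open>s > 0\<close> the set also contains the negative reals,
  which carry no \<open>nu\<close> mass.\<close>

definition W :: "ennreal \<Rightarrow> ennreal" where "W s = emeasure nu {t. ennreal t < s}"

lemma w_pos: "t \<in> P \<Longrightarrow> w t > 0"
  using weight by (auto simp: weight_def P_def)

lemma w_antimono: "0 < s \<Longrightarrow> s \<le> t \<Longrightarrow> t \<in> P \<Longrightarrow> w t \<le> w s"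
  using weight by (auto simp: weight_def P_def)

lemma P_downward: "t \<in> P \<Longrightarrow> 0 < s \<Longrightarrow> s \<le> t \<Longrightarrow> s \<in> P"
  by (auto simp: P_def intro: le_less_trans[of "ereal s" "ereal t"])

lemma P_borel [measurable]: "P \<in> sets borel"
proof -
  have "{t \<in> space borel. 0 < t \<and> ereal t < \<gamma>} \<in> sets borel" by measurable
  then show ?thesis by (simp add: P_def)
qed

lemma P_subset_interval: "P \<subseteq> interval \<gamma>" and interval_subset_P: "interval \<gamma> \<subseteq> insert 0 P"
  by (auto simp: P_def interval_def)

lemma measurable_om [measurable]: "om \<in> borel_measurable borel"
proof -
  have "mono_on P (\<lambda>t. - w t)"
    by (auto simp: mono_on_def intro!: w_antimono) (simp add: P_def)
  then have "(\<lambda>t. - w t) \<in> borel_measurable (restrict_space borel P)"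
    by (rule borel_measurable_mono_on_fnc)
  then have "(\<lambda>t. - (- w t)) \<in> borel_measurable (restrict_space borel P)"
    by (rule borel_measurable_uminus)
  then have "(\<lambda>t. ennreal (w t)) \<in> borel_measurable (restrict_space borel P)"
    by (intro measurable_compose[OF _ measurable_ennreal]) simp
  then show ?thesis
    unfolding om_def[abs_def] by (subst (asm) borel_measurable_restrict_space_iff_ennreal) auto
qed

lemma sets_nu [measurable_cong, simp]: "sets nu = sets borel" and space_nu [simp]: "space nu = UNIV"
  by (auto simp: nu_def)

lemma emeasure_nu: "E \<in> sets borel \<Longrightarrow> emeasure nu E = (\<integral>\<^sup>+t. om t * indicator E t \<partial>lborel)"
  unfolding nu_def by (rule emeasure_density) auto

lemma emeasure_nu_P:
  assumes [measurable]: "E \<in> sets borel"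
  shows "emeasure nu (E \<inter> P) = emeasure nu E"
  by (simp add: emeasure_nu om_def) (auto intro!: nn_integral_cong simp: indicator_def)

lemma nu_mono: "E \<subseteq> F \<Longrightarrow> F \<in> sets borel \<Longrightarrow> emeasure nu E \<le> emeasure nu F"
  by (rule emeasure_mono) auto

lemma nu_split:
  assumes [measurable]: "E \<in> sets borel" "F \<in> sets borel"
  shows "emeasure nu E = emeasure nu (E \<inter> F) + emeasure nu (E - F)"
  by (subst plus_emeasure) (auto intro!: arg_cong[where f = "emeasure nu"])

text \<open>A decreasing density is at most \<open>w r\<close> past \<open>r\<close> and at least
  \<open>w r\<close> before it. This lemma and the next trade \<open>nu\<close> against Lebesgue
  measure.\<close>

lemma nu_le:
  assumes [measurable]: "E \<in> sets borel" and "r \<in> P" "E \<subseteq> {r..}"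
  shows "emeasure nu E \<le> ennreal (w r) * emeasure lborel (E \<inter> P)"
proof -
  have "emeasure nu E \<le> (\<integral>\<^sup>+t. ennreal (w r) * indicator (E \<inter> P) t \<partial>lborel)"
    unfolding emeasure_nu[OF assms(1)] om_def using assms
    by (intro nn_integral_mono) (auto simp: indicator_def P_def intro!: ennreal_leI w_antimono)
  also have "\<dots> = ennreal (w r) * emeasure lborel (E \<inter> P)"
    by (subst nn_integral_cmult_indicator) auto
  finally show ?thesis .
qed

lemma nu_ge:
  assumes [measurable]: "E \<in> sets borel" and "r \<in> P" "E \<subseteq> {0<..r}"
  shows "ennreal (w r) * emeasure lborel E \<le> emeasure nu E"
proof -
  have "ennreal (w r) * emeasure lborel E = (\<integral>\<^sup>+t. ennreal (w r) * indicator E t \<partial>lborel)"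
    by (subst nn_integral_cmult_indicator) auto
  also have "\<dots> \<le> emeasure nu E"
    unfolding emeasure_nu[OF assms(1)] om_def using assms(2,3)
    by (intro nn_integral_mono)
      (auto simp: indicator_def subset_iff intro!: ennreal_leI w_antimono dest: P_downward)
  finally show ?thesis .
qed

section \<open>The primitive of the weight: rearrangement bound, subadditivity, continuity\<close>

lemma W_ennreal:
  assumes "0 < r"
  shows "W (ennreal r) = emeasure nu {..<r}"
proof -
  have "ennreal t < ennreal r \<longleftrightarrow> t < r" for t
    using assms by (cases "t \<le> 0") (auto simp: ennreal_less_iff ennreal_neg)
  then show ?thesis by (simp add: W_def lessThan_def)
qed

lemma W_0 [simp]: "W 0 = 0"
  by (simp add: W_def)

lemma ennreal_lessThan_borel [measurable]: "{t. ennreal t < s} \<in> sets borel"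
proof -
  have "{t \<in> space borel. ennreal t < s} \<in> sets borel" by measurable
  then show ?thesis by simp
qed

lemma W_mono: "s \<le> t \<Longrightarrow> W s \<le> W t"
  unfolding W_def by (intro nu_mono) auto

lemma emeasure_lessThan_P:
  assumes "0 < r" "r \<in> P"
  shows "emeasure lborel ({..<r} \<inter> P) = ennreal r"
proof -
  have "{..<r} \<inter> P = {0<..<r}"
    using assms P_downward[of r] by (auto simp: P_def)
  then show ?thesis using assms by simp
qed

text \<open>Bathtub principle. The part of \<open>E\<close> beyond \<open>r\<close> is exchanged for
  the gaps that \<open>E\<close> leaves before \<open>r\<close>: it is no larger in Lebesgue
  measure, and \<open>w r\<close> separates the two densities.\<close>

lemma nu_le_W:
  assumes E [measurable]: "E \<in> sets borel" and le: "emeasure lborel (E \<inter> P) \<le> s"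
  shows "emeasure nu E \<le> W s"
proof (cases s)
  case top
  then show ?thesis
    using nu_mono[of E "{t. ennreal t < \<infinity>}"] by (simp add: W_def)
next
  case (real r)
  show ?thesis
  proof (cases "r = 0")
    case True
    then have "emeasure lborel (E \<inter> P) = 0" using real le by simp
    then have "E \<inter> P \<in> null_sets lborel" by (auto simp: null_sets_def)
    then have "AE t in lborel. t \<notin> E \<inter> P" by (rule AE_not_in)
    then have "(\<integral>\<^sup>+t. om t * indicator E t \<partial>lborel) = (\<integral>\<^sup>+t. 0 \<partial>(lborel::real measure))"
      by (intro nn_integral_cong_AE) (auto simp: om_def indicator_def elim!: eventually_mono)
    then show ?thesis by (simp add: emeasure_nu)
  next
    case False
    then have r: "0 < r" using real by simp
    let ?S = "{..<r}"
    show ?thesis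
    proof (cases "r \<in> P")
      case False
      then have "\<gamma> \<le> ereal r" using r by (auto simp: P_def)
      then have "P \<subseteq> ?S" by (auto simp: P_def dest: less_le_trans)
      then have "emeasure nu (E \<inter> P) \<le> emeasure nu ?S" by (intro nu_mono) auto
      then show ?thesis using real r by (simp add: emeasure_nu_P W_ennreal)
    next
      case True
      have "emeasure lborel (E \<inter> ?S \<inter> P) + emeasure lborel ((E - ?S) \<inter> P) = emeasure lborel (E \<inter> P)"
        by (subst plus_emeasure) (auto intro!: arg_cong[where f = "emeasure lborel"])
      also have "\<dots> \<le> emeasure lborel (?S \<inter> P)"
        using le real by (simp add: emeasure_lessThan_P[OF r True])
      also have "\<dots> = emeasure lborel (E \<inter> ?S \<inter> P) + emeasure lborel ((?S - E) \<inter> P)"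
        by (subst plus_emeasure) (auto intro!: arg_cong[where f = "emeasure lborel"])
      finally have *: "emeasure lborel (E \<inter> ?S \<inter> P) + emeasure lborel ((E - ?S) \<inter> P)
          \<le> emeasure lborel (E \<inter> ?S \<inter> P) + emeasure lborel ((?S - E) \<inter> P)" .
      \<comment> \<open>Finiteness of the common part allows it to be cancelled in
        \<open>ennreal\<close>.\<close>
      have "emeasure lborel (E \<inter> ?S \<inter> P) \<le> emeasure lborel (?S \<inter> P)"
        by (intro emeasure_mono) auto
      also have "\<dots> < \<infinity>" by (simp add: emeasure_lessThan_P[OF r True])
      finally have "emeasure lborel (E \<inter> ?S \<inter> P) \<noteq> \<infinity>" by simp
      with * have m: "emeasure lborel ((E - ?S) \<inter> P) \<le> emeasure lborel ((?S - E) \<inter> P)"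
        by (simp add: ennreal_add_left_cancel_le)
      have "emeasure nu (E - ?S) \<le> ennreal (w r) * emeasure lborel ((E - ?S) \<inter> P)"
        using True by (intro nu_le) auto
      also have "\<dots> \<le> ennreal (w r) * emeasure lborel ((?S - E) \<inter> P)"
        using m by (rule mult_left_mono) simp
      also have "\<dots> \<le> emeasure nu ((?S - E) \<inter> P)"
        using True by (intro nu_ge) (auto simp: P_def)
      also have "\<dots> = emeasure nu (?S - E)" by (simp add: emeasure_nu_P)
      finally have "emeasure nu E \<le> emeasure nu ?S"
        using nu_split[of E ?S] nu_split[of ?S E] by (simp add: Int_commute add_left_mono)
      then show ?thesis using real r by (simp add: W_ennreal)
    qed
  qed
qed

text \<open>The part of the initial interval beyond \<open>s\<close> has Lebesgue measure at most
  \<open>t\<close>, so \<open>nu_le_W\<close> bounds its mass by that of an interval of length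
  \<open>t\<close> at the origin.\<close>

lemma W_add_le: "W (s + t) \<le> W s + W t"
proof (cases s)
  case top
  then show ?thesis by simp
next
  case (real r)
  let ?E = "{x. ennreal x < s + t}"
  have "emeasure nu ?E = emeasure nu (?E \<inter> {x. ennreal x < s}) + emeasure nu (?E - {x. ennreal x < s})"
    by (intro nu_split) auto
  also have "\<dots> \<le> W s + W t"
  proof (rule add_mono)
    show "emeasure nu (?E \<inter> {x. ennreal x < s}) \<le> W s"
      unfolding W_def by (intro nu_mono) auto
    show "emeasure nu (?E - {x. ennreal x < s}) \<le> W t"
    proof (rule nu_le_W)
      show "emeasure lborel ((?E - {x. ennreal x < s}) \<inter> P) \<le> t"
      proof (cases t)
        case (real q)
        have "(?E - {x. ennreal x < s}) \<inter> P \<subseteq> {r..r + q}"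
          using \<open>s = ennreal r\<close> \<open>t = ennreal q\<close> \<open>0 \<le> r\<close> \<open>0 \<le> q\<close>
          by (auto simp: P_def ennreal_less_iff not_less simp flip: ennreal_plus)
        then have "emeasure lborel ((?E - {x. ennreal x < s}) \<inter> P) \<le> emeasure lborel {r..r + q}"
          by (intro emeasure_mono) auto
        then show ?thesis using real by simp
      qed simp
    qed measurable
  qed
  finally show ?thesis by (simp add: W_def)
qed

lemma W_pos:
  assumes "0 < s"
  shows "0 < W s"
proof -
  obtain r where r: "0 < r" "r \<in> P"
    using \<gamma>_pos ereal_dense2[of 0 \<gamma>] by (force simp: P_def)
  obtain q where q: "0 < q" "ennreal q < s"
    using assms by (metis dense ennreal_cases ennreal_less_zero_iff top.extremum_strict)
  define v where "v = min r q"
  have v: "0 < v" "v \<in> P" "ennreal v \<le> s"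
    using r q P_downward[of r v] by (auto simp: v_def min_def intro: order_trans[OF ennreal_leI])
  have "0 < ennreal (w v) * emeasure lborel {0<..<v}"
    using v w_pos[of v] by (simp add: ennreal_zero_less_mult_iff)
  also have "\<dots> \<le> emeasure nu {0<..<v}"
    using v by (intro nu_ge) auto
  also have "\<dots> \<le> emeasure nu {..<v}"
    by (intro nu_mono) auto
  also have "\<dots> \<le> W s" using v W_mono[of "ennreal v" s] by (simp add: W_ennreal)
  finally show ?thesis .
qed

lemma W_finite:
  assumes "r \<in> P"
  shows "W (ennreal r) < \<infinity>"
proof -
  have r: "0 < r" using assms by (simp add: P_def)
  have "W (ennreal r) = (\<integral>\<^sup>+t. om t * indicator {..<r} t \<partial>lborel)"
    using r by (simp add: W_ennreal emeasure_nu)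
  also have "\<dots> \<le> (\<integral>\<^sup>+ s \<in> {0..r}. ennreal (w s) \<partial>lborel)"
    by (intro nn_integral_mono) (auto simp: om_def P_def indicator_def)
  also have "\<dots> = (\<integral>\<^sup>+ s \<in> {0..r}. ennreal (w s) \<partial>lebesgue)"
    by (simp add: nn_integral_completion)
  also have "\<dots> < \<infinity>"
    using weight assms P_subset_interval by (auto simp: weight_def)
  finally show ?thesis .
qed

lemma exists_in_P: obtains t where "0 < t" "t \<in> P"
  using \<gamma>_pos ereal_dense2[of 0 \<gamma>] by (force simp: P_def)

text \<open>\<open>weight\<close> grants finite integrals only up to interior points. Past an
  interior \<open>t\<close> the density is at most \<open>w t\<close> and, \<gamma> being finite,
  lives on a bounded set.\<close>

lemma W_bounded:
  assumes "\<gamma> < \<infinity>"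
  shows "W s \<le> W \<infinity>" "W \<infinity> < \<infinity>"
proof -
  show "W s \<le> W \<infinity>" by (intro W_mono) simp
  obtain t where t: "0 < t" "t \<in> P" by (rule exists_in_P)
  obtain g where g: "\<gamma> = ereal g" using assms \<gamma>_pos by (cases \<gamma>) auto
  have "W \<infinity> = emeasure nu UNIV" by (simp add: W_def)
  also have "\<dots> = emeasure nu (UNIV \<inter> {..<t}) + emeasure nu (UNIV - {..<t})"
    by (intro nu_split) auto
  also have "\<dots> < \<infinity>"
  proof -
    have "emeasure nu (UNIV - {..<t}) \<le> ennreal (w t) * emeasure lborel ((UNIV - {..<t}) \<inter> P)"
      using t by (intro nu_le) auto
    also have "\<dots> \<le> ennreal (w t) * emeasure lborel {0..g}"
      using g by (intro mult_left_mono emeasure_mono) (auto simp: P_def[unfolded g])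
    also have "\<dots> < \<infinity>"
      using g \<gamma>_pos by (auto simp: ennreal_mult_less_top)
    finally show ?thesis
      using W_finite[OF t(2)] t by (simp add: W_ennreal)
  qed
  finally show "W \<infinity> < \<infinity>" .
qed

text \<open>Continuity of \<open>nu\<close> from above; cutting the initial intervals with
  \<open>P\<close> makes their intersection empty.\<close>

lemma W_small:
  assumes "0 < e"
  obtains \<theta> where "0 < \<theta>" "\<theta> \<in> P" "W (ennreal \<theta>) < e"
proof -
  obtain t where t: "0 < t" "t \<in> P" by (rule exists_in_P)
  define A where "A n = {..<t / Suc n} \<inter> P" for n
  have "(\<lambda>n. emeasure nu (A n)) \<longlonglongrightarrow> emeasure nu (\<Inter>n. A n)"
  proof (rule Lim_emeasure_decseq)
    show "range A \<subseteq> sets nu" by (auto simp: A_def)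
    show "decseq A"
      unfolding decseq_def
    proof (intro allI impI)
      fix m n :: nat assume "m \<le> n"
      then have "t / Suc n \<le> t / Suc m" using t by (intro divide_left_mono) auto
      then show "A n \<subseteq> A m" by (auto simp: A_def)
    qed
    fix n
    have "emeasure nu (A n) \<le> emeasure nu {..<t}"
    proof (intro nu_mono)
      have "t / Suc n \<le> t" using t by (simp add: divide_le_eq)
      then show "A n \<subseteq> {..<t}" by (auto simp: A_def)
    qed auto
    then show "emeasure nu (A n) \<noteq> \<infinity>"
      using W_finite[OF t(2)] t by (auto simp: W_ennreal top_unique)
  qed
  also have "(\<Inter>n. A n) = {}"
  proof -
    have "x \<notin> (\<Inter>n. A n)" for x
    proof
      assume x: "x \<in> (\<Inter>n. A n)"
      then have "x > 0" by (auto simp: A_def P_def)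
      then obtain n where "t / x < real n" using reals_Archimedean2 by blast
      then have "t < x * Suc n" using \<open>x > 0\<close> by (simp add: field_simps)
      moreover have "x < t / Suc n" using x by (auto simp: A_def)
      then have "x * Suc n < t" by (simp add: pos_less_divide_eq)
      ultimately show False by simp
    qed
    then show ?thesis by blast
  qed
  finally have "(\<lambda>n. emeasure nu (A n)) \<longlonglongrightarrow> 0" by simp
  then have "\<forall>\<^sub>F n in sequentially. emeasure nu (A n) < e"
    using assms by (rule order_tendstoD)
  then obtain n where n: "emeasure nu (A n) < e"
    using eventually_happens' sequentially_bot by blast
  show thesis
  proof (rule that[of "t / Suc n"])
    show "0 < t / Suc n" using t by simp
    have "t / Suc n \<le> t" using t by (simp add: divide_le_eq)
    then show "t / Suc n \<in> P" using t P_downward[of t "t / Suc n"] by simp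
    show "W (ennreal (t / Suc n)) < e"
      using n t by (simp add: W_ennreal A_def emeasure_nu_P)
  qed
qed

text \<open>Subadditivity turns smallness of \<open>W\<close> near 0 into continuity up to
  \<open>t\<close>, and the intermediate value theorem gives \<open>a\<close>. \<open>F\<close> is
  the real-valued copy of \<open>W\<close>, faithful up to \<open>t\<close> because \<open>t\<close>
  lies in \<open>P\<close>.\<close>

lemma W_surj:
  assumes t: "t \<in> P" and v: "0 < v" "ennreal v < W (ennreal t)"
  obtains a where "0 < a" "a \<in> P" "W (ennreal a) = ennreal v"
proof -
  have t0: "0 < t" using t by (simp add: P_def)
  have fin: "W (ennreal s) < \<infinity>" if "s \<le> t" for s
    using W_finite[OF t] W_mono[of "ennreal s" "ennreal t"] that
    by (auto intro: le_less_trans ennreal_leI)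
  define F where "F s = enn2real (W (ennreal s))" for s
  have F: "ennreal (F s) = W (ennreal s)" if "s \<le> t" for s
    using fin[OF that] by (simp add: F_def)
  have F_nonneg: "0 \<le> F s" for s by (simp add: F_def)
  have F_mono: "F s \<le> F r" if "s \<le> r" "r \<le> t" for s r
    unfolding F_def using that fin[of r] by (intro enn2real_mono W_mono ennreal_leI) auto
  have F_diff: "F r \<le> F s + F (r - s)" if "0 \<le> s" "s \<le> r" "r \<le> t" for s r
  proof -
    have "ennreal (F r) \<le> ennreal (F s + F (r - s))"
      using W_add_le[of "ennreal s" "ennreal (r - s)"] that F[of r] F[of s] F[of "r - s"] F_nonneg
      by (simp add: ennreal_plus[OF F_nonneg F_nonneg] flip: ennreal_plus[of s "r - s"])
    then show ?thesis
      by (rule iffD1[OF ennreal_le_iff, rotated]) (simp add: F_nonneg)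
  qed
  have "continuous_on {0..t} F"
    unfolding continuous_on_iff
  proof (intro ballI allI impI)
    fix s e :: real assume s: "s \<in> {0..t}" and e: "0 < e"
    obtain \<theta> where \<theta>: "0 < \<theta>" "\<theta> \<in> P" "W (ennreal \<theta>) < ennreal e"
      using W_small[of "ennreal e"] e by auto
    define d where "d = min \<theta> t"
    have d: "0 < d" "d \<le> t" "F d < e"
    proof -
      have "ennreal (F d) < ennreal e"
        using \<theta>(3) F[of d] W_mono[of "ennreal d" "ennreal \<theta>"]
        by (auto simp: d_def ennreal_leI intro: le_less_trans)
      then show "F d < e" using F_nonneg by (simp add: ennreal_less_iff)
    qed (use \<theta> t0 in \<open>auto simp: d_def\<close>)
    have near: "\<bar>F r - F s\<bar> < e" if "0 \<le> s" "s \<le> r" "r \<le> t" "r - s < d" for r s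
      using F_mono[of s r] F_diff[of s r] F_mono[of "r - s" d] d that by auto
    show "\<exists>d>0. \<forall>r\<in>{0..t}. dist r s < d \<longrightarrow> dist (F r) (F s) < e"
    proof (intro exI conjI ballI impI)
      fix r assume "r \<in> {0..t}" "dist r s < d"
      then show "dist (F r) (F s) < e"
        using near[of r s] near[of s r] s
        by (cases "s \<le> r") (auto simp: dist_real_def abs_minus_commute)
    qed (rule d(1))
  qed
  moreover have "F 0 \<le> v" using v by (simp add: F_def)
  moreover have "v \<le> F t"
    using v F[of t] F_nonneg[of t] by (metis ennreal_less_iff less_eq_real_def order_refl)
  ultimately obtain a where a: "0 \<le> a" "a \<le> t" "F a = v"
    using IVT'[of F 0 v t] t0 by auto
  have "a \<noteq> 0" using a v by (auto simp: F_def)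
  then show thesis
    using that[of a] a F[of a] P_downward[OF t, of a] by auto
qed

end

section \<open>Distribution functions and the modular\<close>

text \<open>A Borel representative of the class: its level sets are Borel, and Fubini can be used
  for \<open>lborel\<close> with no completion in the product.\<close>

definition brep :: "lebfun \<Rightarrow> real \<Rightarrow> real" where
  "brep X = (SOME y. y \<in> borel_measurable borel \<and> (AE t in lborel. rep_lebfun X t = y t))"

lemma rep_lebfun_measurable: "rep_lebfun X \<in> borel_measurable lebesgue"
  using Quotient_rep_reflp[OF Quotient_lebfun, of X] by simp

lemma rep_abs_lebfun: "f \<in> borel_measurable lebesgue \<Longrightarrow> AE t in lebesgue. rep_lebfun (abs_lebfun f) t = f t"
  using Quotient_rep_abs[OF Quotient_lebfun, of f] by auto

lemma brep_measurable [measurable]: "brep X \<in> borel_measurable borel"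
  and brep_AE: "AE t in lborel. rep_lebfun X t = brep X t"
proof -
  have "\<exists>y. y \<in> borel_measurable borel \<and> (AE t in lborel. rep_lebfun X t = y t)"
    using completion_ex_borel_measurable_real[OF rep_lebfun_measurable[of X]] by auto
  from someI_ex[OF this] show "brep X \<in> borel_measurable borel" "AE t in lborel. rep_lebfun X t = brep X t"
    unfolding brep_def by auto
qed

lemma borel_imp_lebesgue: "f \<in> borel_measurable borel \<Longrightarrow> f \<in> borel_measurable lebesgue"
  by (rule measurable_completion) simp

lemma brep_abs:
  assumes "f \<in> borel_measurable lebesgue"
  shows "AE t in lborel. brep (abs_lebfun f) t = f t"
  using rep_abs_lebfun[OF assms, unfolded AE_completion_iff] brep_AE[of "abs_lebfun f"]
  by eventually_elim simp

lemma abs_brep: "abs_lebfun (brep X) = X"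
proof -
  have "abs_lebfun (brep X) = abs_lebfun (rep_lebfun X)"
    using brep_AE[of X] brep_measurable[of X] rep_lebfun_measurable[of X]
    by (intro Quotient_rel_abs[OF Quotient_lebfun])
      (auto simp: AE_completion_iff intro: borel_imp_lebesgue elim: eventually_mono)
  then show ?thesis
    by (simp add: Quotient_abs_rep[OF Quotient_lebfun])
qed

lemma brep_add: "AE t in lborel. brep (X + Y) t = brep X t + brep Y t"
proof -
  have "X + Y = abs_lebfun (\<lambda>t. brep X t + brep Y t)"
    using plus_lebfun.abs_eq[of "brep X" "brep Y"] by (simp add: abs_brep borel_imp_lebesgue)
  then show ?thesis using brep_abs[of "\<lambda>t. brep X t + brep Y t"]
    by (simp add: borel_imp_lebesgue)
qed

lemma brep_diff: "AE t in lborel. brep (X - Y) t = brep X t - brep Y t"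
proof -
  have "X - Y = abs_lebfun (\<lambda>t. brep X t - brep Y t)"
    using minus_lebfun.abs_eq[of "brep X" "brep Y"] by (simp add: abs_brep borel_imp_lebesgue)
  then show ?thesis using brep_abs[of "\<lambda>t. brep X t - brep Y t"]
    by (simp add: borel_imp_lebesgue)
qed

lemma brep_scaleR: "AE t in lborel. brep (c *\<^sub>R X) t = c * brep X t"
proof -
  have "c *\<^sub>R X = abs_lebfun (\<lambda>t. c * brep X t)"
    using scaleR_lebfun.abs_eq[of "brep X" c] by (simp add: abs_brep borel_imp_lebesgue)
  then show ?thesis using brep_abs[of "\<lambda>t. c * brep X t"]
    by (simp add: borel_imp_lebesgue)
qed

section \<open>Distribution functions and their duality with the rearrangement\<close>

context weighted
begin

definition dis :: "(real \<Rightarrow> real) \<Rightarrow> real \<Rightarrow> ennreal" where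
  "dis y l = emeasure lborel {t \<in> P. l < \<bar>y t\<bar>}"

lemma level_set_borel:
  fixes y :: "real \<Rightarrow> real"
  assumes [measurable]: "y \<in> borel_measurable borel"
  shows "{t \<in> P. l < \<bar>y t\<bar>} \<in> sets borel"
proof -
  have "{t \<in> space borel. t \<in> P \<and> l < \<bar>y t\<bar>} \<in> sets borel" by measurable
  then show ?thesis by simp
qed

lemma distr_fun_eq: "distr_fun \<gamma> X l = dis (brep X) l"
proof -
  have "distr_fun \<gamma> (abs_lebfun (brep X)) l = emeasure lebesgue {t \<in> interval \<gamma>. l < \<bar>brep X t\<bar>}"
    by (subst distr_fun.abs_eq) (auto intro: borel_imp_lebesgue)
  also have "\<dots> = emeasure lborel {t \<in> interval \<gamma>. l < \<bar>brep X t\<bar>}"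
  proof -
    have "{t \<in> space borel. t \<in> interval \<gamma> \<and> l < \<bar>brep X t\<bar>} \<in> sets borel" by measurable
    then show ?thesis by simp
  qed
  also have "\<dots> = dis (brep X) l"
    unfolding dis_def
  proof (rule emeasure_eq_AE)
    show "AE t in lborel. (t \<in> {t \<in> interval \<gamma>. l < \<bar>brep X t\<bar>}) = (t \<in> {t \<in> P. l < \<bar>brep X t\<bar>})"
      using AE_lborel_singleton[of 0]
      by eventually_elim (use P_subset_interval interval_subset_P in auto)
    have "{t \<in> space borel. t \<in> interval \<gamma> \<and> l < \<bar>brep X t\<bar>} \<in> sets borel" by measurable
    then show "{t \<in> interval \<gamma>. l < \<bar>brep X t\<bar>} \<in> sets lborel" by simp
    show "{t \<in> P. l < \<bar>brep X t\<bar>} \<in> sets lborel" using level_set_borel by simp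
  qed
  finally show ?thesis by (simp add: abs_brep)
qed

lemma dis_cong_AE:
  assumes "y \<in> borel_measurable borel" "z \<in> borel_measurable borel" "AE t in lborel. y t = z t"
  shows "dis y l = dis z l"
  unfolding dis_def using assms level_set_borel
  by (intro emeasure_eq_AE) (auto elim: eventually_mono)

lemma dis_le:
  assumes "z \<in> borel_measurable borel" "\<And>t. t \<in> P \<Longrightarrow> l < \<bar>y t\<bar> \<Longrightarrow> l' < \<bar>z t\<bar>"
  shows "dis y l \<le> dis z l'"
  unfolding dis_def using assms level_set_borel by (intro emeasure_mono) auto

lemma dis_antimono: "y \<in> borel_measurable borel \<Longrightarrow> antimono (dis y)"
  by (intro antimonoI dis_le) auto

lemma dis_measurable [measurable (raw)]:
  assumes "y \<in> borel_measurable borel" "f \<in> borel_measurable M"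
  shows "(\<lambda>x. dis y (f x)) \<in> borel_measurable M"
  using measurable_compose[OF assms(2) antimono_borel_measurable_ennreal[OF dis_antimono[OF assms(1)]]] .

lemma W_dis_measurable [measurable (raw)]:
  assumes "y \<in> borel_measurable borel" "f \<in> borel_measurable M"
  shows "(\<lambda>x. W (dis y (f x))) \<in> borel_measurable M"
proof -
  have "antimono (\<lambda>l. W (dis y l))"
    by (intro antimonoI W_mono antimonoD[OF dis_antimono] assms)
  from measurable_compose[OF assms(2) antimono_borel_measurable_ennreal[OF this]] show ?thesis .
qed

lemma dis_scale: "0 < c \<Longrightarrow> dis (\<lambda>t. c * y t) l = dis y (l / c)"
  unfolding dis_def by (simp add: abs_mult pos_divide_less_eq mult.commute)

lemma dis_SUP:
  assumes y: "y \<in> borel_measurable borel"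
    and f: "decseq f" "f \<longlonglongrightarrow> l" "\<And>n. l < f n"
  shows "dis y l = (SUP n. dis y (f n))"
proof -
  have "(SUP n. emeasure lborel {t \<in> P. f n < \<bar>y t\<bar>}) = emeasure lborel (\<Union>n. {t \<in> P. f n < \<bar>y t\<bar>})"
  proof (rule SUP_emeasure_incseq)
    show "range (\<lambda>n. {t \<in> P. f n < \<bar>y t\<bar>}) \<subseteq> sets lborel"
      using level_set_borel[OF y] by auto
    show "incseq (\<lambda>n. {t \<in> P. f n < \<bar>y t\<bar>})"
      using f(1) by (auto simp: incseq_def decseq_def intro: le_less_trans)
  qed
  also have "(\<Union>n. {t \<in> P. f n < \<bar>y t\<bar>}) = {t \<in> P. l < \<bar>y t\<bar>}"
  proof -
    have "\<exists>n. f n < a" if "l < a" for a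
      using order_tendstoD(2)[OF f(2) that] eventually_happens' sequentially_bot by blast
    then show ?thesis using f(3) by (auto intro: less_trans)
  qed
  finally show ?thesis by (simp add: dis_def)
qed

lemma dis_right_continuous:
  assumes y: "y \<in> borel_measurable borel" and s: "s < dis y l"
  obtains l' where "l < l'" "s < dis y l'"
proof -
  have "dis y l = (SUP n. dis y (l + inverse (real (Suc n))))"
  proof (rule dis_SUP[OF y])
    show "decseq (\<lambda>n. l + inverse (real (Suc n)))"
      by (auto simp: decseq_def intro!: le_imp_inverse_le)
    show "(\<lambda>n. l + inverse (real (Suc n))) \<longlonglongrightarrow> l"
      by (rule LIMSEQ_inverse_real_of_nat_add)
  qed auto
  then obtain n where "s < dis y (l + inverse (real (Suc n)))"
    using s by (auto simp: less_SUP_iff)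
  then show thesis by (intro that[of "l + inverse (real (Suc n))"]) auto
qed

text \<open>The delicate direction is from right to left: right continuity of \<open>dis\<close>
  supplies a level \<open>l' > l\<close> that still satisfies the condition, and this gap makes the
  inequality strict.\<close>

lemma less_decr_rearr_iff:
  assumes "0 \<le> l"
  shows "ennreal l < decr_rearr \<gamma> X t \<longleftrightarrow> ennreal t < dis (brep X) l"
proof
  assume *: "ennreal l < decr_rearr \<gamma> X t"
  show "ennreal t < dis (brep X) l"
  proof (rule ccontr)
    assume "\<not> ennreal t < dis (brep X) l"
    then have "decr_rearr \<gamma> X t \<le> ennreal l"
      unfolding decr_rearr_def distr_fun_eq using assms by (intro Inf_lower) auto
    with * show False by simp
  qed
next
  assume "ennreal t < dis (brep X) l"
  then obtain l' where l': "l < l'" "ennreal t < dis (brep X) l'"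
    using dis_right_continuous[of "brep X"] by auto
  have "ennreal l' \<le> decr_rearr \<gamma> X t"
    unfolding decr_rearr_def distr_fun_eq
  proof (intro Inf_greatest, clarify)
    fix r assume r: "0 \<le> r" "dis (brep X) r \<le> ennreal t"
    then have "dis (brep X) r < dis (brep X) l'" using l' by auto
    then have "l' \<le> r" using antimonoD[OF dis_antimono[of "brep X"], of r l'] by (force simp: not_le[symmetric])
    then show "ennreal l' \<le> ennreal r" by (simp add: ennreal_leI)
  qed
  moreover have "ennreal l < ennreal l'" using l' assms by (simp add: ennreal_less_iff)
  ultimately show "ennreal l < decr_rearr \<gamma> X t" by simp
qed

end

section \<open>The modular as an integral over levels\<close>

locale orlicz_lorentz = weighted \<gamma> w + orlicz \<phi> for \<gamma> w \<phi>
begin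

definition rho :: "(real \<Rightarrow> real) \<Rightarrow> ennreal" where
  "rho y = (\<integral>\<^sup>+l. W (dis y l) * Psi l \<partial>lborel)"

text \<open>Fubini on the region under the graph of the rearrangement: its slice at level
  \<open>l\<close> is the initial interval of length \<open>dis (brep X) l\<close>, whose mass is
  given by \<open>W\<close>.\<close>

lemma OL_modular_eq_rho: "OL_modular \<gamma> \<phi> w X = rho (brep X)"
proof -
  let ?y = "brep X"
  \<comment> \<open>The region is described by \<open>dis\<close> and not by the rearrangement,
    because monotonicity of \<open>dis\<close> makes it jointly Borel.\<close>
  let ?ind = "\<lambda>(t, l). indicator {p. ennreal (fst p) < dis ?y (snd p)} (t, l) :: ennreal"
  have ind [measurable]: "{p. ennreal (fst p) < dis ?y (snd p)} \<in> sets (borel \<Otimes>\<^sub>M borel)"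
  proof -
    have "{p \<in> space (borel \<Otimes>\<^sub>M borel). ennreal (fst p) < dis ?y (snd p)} \<in> sets (borel \<Otimes>\<^sub>M borel)"
      by measurable
    then show ?thesis by (simp add: space_pair_measure)
  qed
  have "OL_modular \<gamma> \<phi> w X =
      (\<integral>\<^sup>+ t. orlicz_ext \<phi> (decr_rearr \<gamma> X t) * ennreal (w t) * indicator (interval \<gamma>) t \<partial>lborel)"
    by (simp add: OL_modular_def nn_integral_completion)
  also have "\<dots> = (\<integral>\<^sup>+ t. (\<integral>\<^sup>+ l. om t * Psi l * ?ind (t, l) \<partial>lborel) \<partial>lborel)"
  proof (rule nn_integral_cong_AE)
    have eq: "orlicz_ext \<phi> (decr_rearr \<gamma> X t) = (\<integral>\<^sup>+ l. Psi l * ?ind (t, l) \<partial>lborel)" for t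
      unfolding orlicz_ext_eq_nn_integral
    proof (rule nn_integral_cong)
      fix l
      show "Psi l * indicator {l. ennreal l < decr_rearr \<gamma> X t} l = Psi l * ?ind (t, l)"
        using less_decr_rearr_iff[of l X t] by (cases "l \<le> 0") (auto simp: indicator_def)
    qed
    have eq': "om t * orlicz_ext \<phi> (decr_rearr \<gamma> X t) = (\<integral>\<^sup>+ l. om t * Psi l * ?ind (t, l) \<partial>lborel)" for t
      unfolding eq mult.assoc by (rule nn_integral_cmult[symmetric]) measurable
    show "AE t in lborel. orlicz_ext \<phi> (decr_rearr \<gamma> X t) * ennreal (w t) * indicator (interval \<gamma>) t =
        (\<integral>\<^sup>+ l. om t * Psi l * ?ind (t, l) \<partial>lborel)"
      using AE_lborel_singleton[of 0]
    proof eventually_elim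
      case (elim t)
      then have "indicator (interval \<gamma>) t = (indicator P t :: ennreal)"
        using P_subset_interval interval_subset_P by (auto simp: indicator_def)
      then show ?case
        by (simp only: eq'[symmetric]) (simp add: om_def mult.commute mult.left_commute)
    qed
  qed
  also have "\<dots> = (\<integral>\<^sup>+ l. (\<integral>\<^sup>+ t. om t * Psi l * ?ind (t, l) \<partial>lborel) \<partial>lborel)"
    by (rule lborel_pair.Fubini'[symmetric]) (simp, measurable)
  also have "\<dots> = rho ?y"
    unfolding rho_def
  proof (rule nn_integral_cong)
    fix l
    have "(\<integral>\<^sup>+ t. om t * Psi l * ?ind (t, l) \<partial>lborel) =
        (\<integral>\<^sup>+ t. Psi l * (om t * indicator {t. ennreal t < dis ?y l} t) \<partial>lborel)"
      by (intro nn_integral_cong) (auto simp: indicator_def mult.commute)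
    also have "\<dots> = Psi l * W (dis ?y l)"
      unfolding W_def by (subst emeasure_nu) (auto intro!: nn_integral_cmult)
    finally show "(\<integral>\<^sup>+ t. om t * Psi l * ?ind (t, l) \<partial>lborel) = W (dis ?y l) * Psi l"
      by (simp add: mult.commute)
  qed
  finally show ?thesis .
qed

lemma rho_cong_AE:
  assumes "y \<in> borel_measurable borel" "z \<in> borel_measurable borel" "AE t in lborel. y t = z t"
  shows "rho y = rho z"
  unfolding rho_def using dis_cong_AE[OF assms] by simp

lemma rho_scale_le:
  assumes [measurable]: "y \<in> borel_measurable borel" and "0 < c" "c \<le> d"
  shows "rho (\<lambda>t. c * y t) \<le> rho (\<lambda>t. d * y t)"
  unfolding rho_def
proof (intro nn_integral_mono mult_right_mono W_mono dis_le)
  fix l t assume "l < \<bar>c * y t\<bar>"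
  also have "\<bar>c * y t\<bar> \<le> \<bar>d * y t\<bar>"
    using assms by (simp add: abs_mult mult_right_mono)
  finally show "l < \<bar>d * y t\<bar>" .
qed auto

text \<open>The substitution moves the dilation from the function to \<open>psi\<close>, where the
  doubling condition can act on it.\<close>

lemma rho_scale:
  assumes [measurable]: "y \<in> borel_measurable borel" and c: "0 < c"
  shows "rho (\<lambda>t. c * y t) = ennreal c * (\<integral>\<^sup>+l. W (dis y l) * Psi (c * l) \<partial>lborel)"
proof -
  have "rho (\<lambda>t. c * y t) = (\<integral>\<^sup>+l. W (dis y (l / c)) * Psi l \<partial>lborel)"
    unfolding rho_def dis_scale[OF c] ..
  also have "\<dots> = ennreal \<bar>c\<bar> * (\<integral>\<^sup>+l. W (dis y ((0 + c * l) / c)) * Psi (0 + c * l) \<partial>lborel)"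
    using c by (intro nn_integral_real_affine) auto
  finally show ?thesis using c by simp
qed

text \<open>The modular form of \<open>\<phi> (c * v) <= c * \<phi> v\<close>; at the level of
  integrands it is monotonicity of \<open>psi\<close>.\<close>

lemma rho_shrink:
  assumes [measurable]: "y \<in> borel_measurable borel" and c: "0 < c" "c \<le> 1"
  shows "rho (\<lambda>t. c * y t) \<le> ennreal c * rho y"
  unfolding rho_scale[OF assms(1) c(1)]
proof (rule mult_left_mono)
  show "(\<integral>\<^sup>+l. W (dis y l) * Psi (c * l) \<partial>lborel) \<le> rho y"
    unfolding rho_def
  proof (intro nn_integral_mono mult_left_mono ennreal_leI)
    fix l show "psi (c * l) \<le> psi l"
    proof (cases "l \<le> 0")
      case True
      then show ?thesis using c by (simp add: mult_nonneg_nonpos)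
    next
      case False
      then show ?thesis using c by (intro psi_mono) (simp add: mult_le_cancel_right1)
    qed
  qed simp
qed simp

lemma dis_add_le:
  assumes [measurable]: "x \<in> borel_measurable borel" "y \<in> borel_measurable borel"
  shows "dis (\<lambda>t. x t + y t) l \<le> dis (\<lambda>t. 2 * x t) l + dis (\<lambda>t. 2 * y t) l"
proof -
  have "{t \<in> P. l < \<bar>x t + y t\<bar>} \<subseteq> {t \<in> P. l < \<bar>2 * x t\<bar>} \<union> {t \<in> P. l < \<bar>2 * y t\<bar>}"
    by auto
  then have "dis (\<lambda>t. x t + y t) l \<le> emeasure lborel ({t \<in> P. l < \<bar>2 * x t\<bar>} \<union> {t \<in> P. l < \<bar>2 * y t\<bar>})"
    unfolding dis_def using level_set_borel by (intro emeasure_mono) auto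
  also have "\<dots> \<le> dis (\<lambda>t. 2 * x t) l + dis (\<lambda>t. 2 * y t) l"
    unfolding dis_def using level_set_borel by (intro emeasure_subadditive) auto
  finally show ?thesis .
qed

text \<open>Stands in for convexity of the modular: a sum exceeds \<open>l\<close> only where one of
  the doubled terms does, and \<open>W\<close> is subadditive. The factor 2 costs nothing, as
  closeness is later obtained at any prescribed scale.\<close>

lemma rho_add_le:
  assumes [measurable]: "x \<in> borel_measurable borel" "y \<in> borel_measurable borel"
  shows "rho (\<lambda>t. x t + y t) \<le> rho (\<lambda>t. 2 * x t) + rho (\<lambda>t. 2 * y t)"
proof -
  have "rho (\<lambda>t. x t + y t)
      \<le> (\<integral>\<^sup>+l. W (dis (\<lambda>t. 2 * x t) l) * Psi l + W (dis (\<lambda>t. 2 * y t) l) * Psi l \<partial>lborel)"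
    unfolding rho_def distrib_right[symmetric]
    using order_trans[OF W_mono[OF dis_add_le] W_add_le] assms
    by (intro nn_integral_mono mult_right_mono) auto
  also have "\<dots> = rho (\<lambda>t. 2 * x t) + rho (\<lambda>t. 2 * y t)"
    unfolding rho_def by (intro nn_integral_add) measurable
  finally show ?thesis .
qed

lemma W_SUP:
  assumes "incseq f"
  shows "W (SUP n. f n) = (SUP n. W (f n))"
proof -
  have "(SUP n. emeasure nu {t. ennreal t < f n}) = emeasure nu (\<Union>n. {t. ennreal t < f n})"
    using assms by (intro SUP_emeasure_incseq) (auto simp: incseq_def intro: less_le_trans)
  also have "(\<Union>n. {t. ennreal t < f n}) = {t. ennreal t < (SUP n. f n)}"
    by (auto simp: less_SUP_iff)
  finally show ?thesis by (simp add: W_def)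
qed

text \<open>Handles norm exactly 1, where the infimum defining the norm need not visibly be
  attained: monotone convergence along \<open>e n\<close> decreasing to 1, using right continuity of
  \<open>dis\<close>.\<close>

lemma rho_le_1_limit:
  assumes [measurable]: "y \<in> borel_measurable borel"
    and le: "\<And>e. 1 < e \<Longrightarrow> rho (\<lambda>t. y t / e) \<le> 1"
  shows "rho y \<le> 1"
proof -
  define e where "e n = 1 + inverse (real (Suc n))" for n
  have e: "1 < e n" for n by (simp add: e_def)
  have e_dec: "e n \<le> e m" if "m \<le> n" for m n
    using that by (auto simp: e_def intro!: le_imp_inverse_le)
  have e_lim: "e \<longlonglongrightarrow> 1"
    unfolding e_def[abs_def] by (rule LIMSEQ_inverse_real_of_nat_add)
  define g where "g n l = W (dis y (e n * l)) * Psi l" for n l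
  have "(\<integral>\<^sup>+l. (SUP n. g n l) \<partial>lborel) = (SUP n. \<integral>\<^sup>+l. g n l \<partial>lborel)"
  proof (rule nn_integral_monotone_convergence_SUP)
    show "incseq g"
      unfolding incseq_def le_fun_def
    proof (intro allI impI)
      fix m n l assume "m \<le> (n::nat)"
      show "g m l \<le> g n l"
      \<comment> \<open>For negative \<open>l\<close> the order of the products
        \<open>e n * l\<close> is reversed, but \<open>psi\<close> vanishes there.\<close>
      proof (cases "l \<le> 0")
        case False
        then show ?thesis
          unfolding g_def using e_dec[OF \<open>m \<le> n\<close>]
          by (intro mult_right_mono W_mono antimonoD[OF dis_antimono]) auto
      qed (simp add: g_def)
    qed
    show "g n \<in> borel_measurable lborel" for n
      unfolding g_def by measurable
  qed
  also have "\<dots> \<le> 1"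
  proof (rule SUP_least)
    fix n
    have "dis y (e n * l) = dis (\<lambda>t. y t / e n) l" for l
      using e[of n] dis_scale[of "inverse (e n)" y l] by (simp add: field_simps)
    then have "(\<integral>\<^sup>+l. g n l \<partial>lborel) = rho (\<lambda>t. y t / e n)"
      by (simp add: g_def rho_def)
    then show "(\<integral>\<^sup>+l. g n l \<partial>lborel) \<le> 1" using le[OF e] by simp
  qed
  also have "(\<integral>\<^sup>+l. (SUP n. g n l) \<partial>lborel) = rho y"
    unfolding rho_def
  proof (rule nn_integral_cong)
    fix l
    show "(SUP n. g n l) = W (dis y l) * Psi l"
    proof (cases "l \<le> 0")
      case False
      have "dis y l = (SUP n. dis y (e n * l))"
      proof (rule dis_SUP)
        show "decseq (\<lambda>n. e n * l)" using e_dec False by (auto simp: decseq_def intro!: mult_right_mono)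
        show "(\<lambda>n. e n * l) \<longlonglongrightarrow> l" using tendsto_mult_right[OF e_lim, of l] by simp
        show "l < e n * l" for n using e[of n] False by simp
      qed measurable
      also have "W \<dots> = (SUP n. W (dis y (e n * l)))"
        using e_dec False
        by (intro W_SUP) (auto simp: incseq_def intro!: antimonoD[OF dis_antimono] mult_right_mono)
      finally show ?thesis unfolding g_def by (simp add: SUP_mult_right_ennreal)
    qed (simp add: g_def)
  qed
  finally show ?thesis .
qed

end

section \<open>The norm and the norming functional\<close>

context orlicz_lorentz
begin

lemma OL_modular_scaleR: "OL_modular \<gamma> \<phi> w (c *\<^sub>R X) = rho (\<lambda>t. c * brep X t)"
  unfolding OL_modular_eq_rho by (intro rho_cong_AE brep_scaleR) auto

lemma OL_norm_eq: "OL_norm \<gamma> \<phi> w X = Inf {e. e > 0 \<and> rho (\<lambda>t. brep X t / e) \<le> 1}"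
  unfolding OL_norm_def OL_modular_scaleR by (simp add: field_simps)

lemma OL_norm_le: "0 < e \<Longrightarrow> rho (\<lambda>t. brep X t / e) \<le> 1 \<Longrightarrow> OL_norm \<gamma> \<phi> w X \<le> e"
  unfolding OL_norm_eq by (intro cInf_lower bdd_belowI[of _ 0]) auto

text \<open>Keeps the infimum in the norm away from the empty set. By \<open>rho_shrink\<close> a
  factor \<open>1 / (M + 1)\<close> brings a finite modular \<open>M\<close> down to at most
  1.\<close>

lemma OL_norm_set_nonempty:
  assumes "X \<in> OL_space \<gamma> \<phi> w"
  shows "{e. e > 0 \<and> rho (\<lambda>t. brep X t / e) \<le> 1} \<noteq> {}"
proof -
  obtain r where r: "0 < r" "rho (\<lambda>t. r * brep X t) < \<infinity>"
    using assms by (auto simp: OL_space_def OL_modular_scaleR)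
  then obtain M where M: "0 \<le> M" "rho (\<lambda>t. r * brep X t) = ennreal M"
    by (cases "rho (\<lambda>t. r * brep X t)") auto
  define s where "s = 1 / (M + 1)"
  have s: "0 < s" "s \<le> 1" "s * M \<le> 1" using M by (auto simp: s_def)
  have "rho (\<lambda>t. s * (r * brep X t)) \<le> ennreal s * ennreal M"
    using rho_shrink[of "\<lambda>t. r * brep X t" s] s M by simp
  also have "\<dots> \<le> 1" using s M by (simp flip: ennreal_mult)
  also have "(\<lambda>t. s * (r * brep X t)) = (\<lambda>t. brep X t / (1 / (s * r)))" by (auto simp: field_simps)
  finally show ?thesis using s r by (intro notI) (auto dest!: spec[of _ "1 / (s * r)"] simp: set_eq_iff)
qed

lemma rho_le_1_if_norm_le_1:
  assumes X: "X \<in> OL_space \<gamma> \<phi> w" and le: "OL_norm \<gamma> \<phi> w X \<le> 1"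
  shows "rho (brep X) \<le> 1"
proof (rule rho_le_1_limit)
  fix e :: real assume e: "1 < e"
  then have "Inf {e. e > 0 \<and> rho (\<lambda>t. brep X t / e) \<le> 1} < e"
    using le unfolding OL_norm_eq by simp
  then obtain d where d: "0 < d" "d < e" "rho (\<lambda>t. brep X t / d) \<le> 1"
    using cInf_lessD[OF OL_norm_set_nonempty[OF X]] by blast
  have "rho (\<lambda>t. (1 / e) * brep X t) \<le> rho (\<lambda>t. (1 / d) * brep X t)"
    using d e by (intro rho_scale_le) (auto simp: frac_le)
  then show "rho (\<lambda>t. brep X t / e) \<le> 1" using d by simp
qed measurable

section \<open>The norming functional and its boundedness\<close>

lemma nn_integral_level_sets:
  assumes [measurable]: "y \<in> borel_measurable borel" "A \<in> sets borel"
  shows "(\<integral>\<^sup>+t. ennreal (y t) * indicator A t \<partial>nu) =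
    (\<integral>\<^sup>+l. emeasure nu (A \<inter> {t. l < y t}) * indicator {0<..} l \<partial>lborel)"
proof -
  have "(\<integral>\<^sup>+t. ennreal (y t) * indicator A t \<partial>nu) = (\<integral>\<^sup>+t. om t * (ennreal (y t) * indicator A t) \<partial>lborel)"
    unfolding nu_def by (rule nn_integral_density) measurable
  also have "\<dots> = (\<integral>\<^sup>+t. (\<integral>\<^sup>+l. om t * indicator A t * (if 0 < l \<and> l < y t then 1 else 0) \<partial>lborel) \<partial>lborel)"
  proof (rule nn_integral_cong)
    fix t
    have "(\<integral>\<^sup>+l. om t * indicator A t * (if 0 < l \<and> l < y t then 1 else 0) \<partial>lborel) =
        om t * indicator A t * (\<integral>\<^sup>+l. indicator {0<..<y t} l \<partial>lborel)"
      by (subst nn_integral_cmult[symmetric]) (auto intro!: nn_integral_cong simp: indicator_def)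
    also have "(\<integral>\<^sup>+l. indicator {0<..<y t} l \<partial>lborel) = ennreal (y t)"
      by (cases "0 \<le> y t") (auto simp: ennreal_neg)
    finally show "om t * (ennreal (y t) * indicator A t) =
        (\<integral>\<^sup>+l. om t * indicator A t * (if 0 < l \<and> l < y t then 1 else 0) \<partial>lborel)"
      by (simp add: mult.commute mult.left_commute)
  qed
  also have "\<dots> = (\<integral>\<^sup>+l. (\<integral>\<^sup>+t. om t * indicator A t * (if 0 < l \<and> l < y t then 1 else 0) \<partial>lborel) \<partial>lborel)"
    by (rule lborel_pair.Fubini'[symmetric]) measurable
  also have "\<dots> = (\<integral>\<^sup>+l. emeasure nu (A \<inter> {t. l < y t}) * indicator {0<..} l \<partial>lborel)"
  proof (rule nn_integral_cong)
    fix l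
    have "{t \<in> space borel. t \<in> A \<and> l < y t} \<in> sets borel" by measurable
    then have m: "A \<inter> {t. l < y t} \<in> sets borel" by (simp add: Int_def)
    show "(\<integral>\<^sup>+t. om t * indicator A t * (if 0 < l \<and> l < y t then 1 else 0) \<partial>lborel) =
      emeasure nu (A \<inter> {t. l < y t}) * indicator {0<..} l"
      unfolding emeasure_nu[OF m]
      by (cases "0 < l") (auto intro!: nn_integral_cong simp: indicator_def)
  qed
  finally show ?thesis .
qed

lemma nu_level_le:
  fixes y :: "real \<Rightarrow> real"
  assumes [measurable]: "y \<in> borel_measurable borel" "A \<in> sets borel"
  shows "emeasure nu (A \<inter> {t. l < y t}) \<le> W (dis y l)"
proof (rule nu_le_W)
  have "{t \<in> space borel. t \<in> A \<and> l < y t} \<in> sets borel" by measurable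
  then show "A \<inter> {t. l < y t} \<in> sets borel" by (simp add: Int_def)
  show "emeasure lborel (A \<inter> {t. l < y t} \<inter> P) \<le> dis y l"
    unfolding dis_def using level_set_borel[OF assms(1)] by (intro emeasure_mono) auto
qed

text \<open>A crude substitute for a Hoelder inequality. Levels up to 1 contribute at most
  \<open>W (ennreal a)\<close>; above 1 the factor \<open>psi l / psi 1\<close> is at least 1, so
  the integrand of the modular dominates.\<close>

lemma nn_integral_abs_le:
  assumes [measurable]: "y \<in> borel_measurable borel" and a: "0 < a"
  shows "(\<integral>\<^sup>+t. ennreal \<bar>y t\<bar> * indicator {0<..<a} t \<partial>nu) \<le> W (ennreal a) + rho y / ennreal (psi 1)"
proof -
  have psi1: "0 < psi 1" by (simp add: psi_pos)
  have dis_abs: "dis (\<lambda>t. \<bar>y t\<bar>) = dis y" by (simp add: dis_def fun_eq_iff)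
  have "(\<integral>\<^sup>+t. ennreal \<bar>y t\<bar> * indicator {0<..<a} t \<partial>nu) =
      (\<integral>\<^sup>+l. emeasure nu ({0<..<a} \<inter> {t. l < \<bar>y t\<bar>}) * indicator {0<..} l \<partial>lborel)"
    by (rule nn_integral_level_sets) measurable
  also have "\<dots> \<le> (\<integral>\<^sup>+l. W (ennreal a) * indicator {0..1} l + W (dis y l) * Psi l / ennreal (psi 1) \<partial>lborel)"
  proof (rule nn_integral_mono)
    fix l :: real
    consider "l \<le> 0" | "0 < l" "l \<le> 1" | "1 < l" by linarith
    then show "emeasure nu ({0<..<a} \<inter> {t. l < \<bar>y t\<bar>}) * indicator {0<..} l
      \<le> W (ennreal a) * indicator {0..1} l + W (dis y l) * Psi l / ennreal (psi 1)"
    proof cases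
      case 2
      have "emeasure nu ({0<..<a} \<inter> {t. l < \<bar>y t\<bar>}) \<le> W (ennreal a)"
        unfolding W_ennreal[OF a] by (intro nu_mono) auto
      then show ?thesis using 2 by (simp add: add_increasing2)
    next
      case 3
      have "emeasure nu ({0<..<a} \<inter> {t. l < \<bar>y t\<bar>}) \<le> W (dis (\<lambda>t. \<bar>y t\<bar>) l)"
        by (intro nu_level_le) measurable
      also have "\<dots> = W (dis y l) * ennreal (psi 1) / ennreal (psi 1)"
        using psi1 by (simp add: dis_abs ennreal_mult_divide_eq)
      also have "\<dots> \<le> W (dis y l) * Psi l / ennreal (psi 1)"
        using 3 by (intro divide_right_mono_ennreal mult_left_mono ennreal_leI psi_mono) auto
      finally show ?thesis using 3 by simp
    qed simp
  qed
  also have "\<dots> = W (ennreal a) + rho y / ennreal (psi 1)"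
    unfolding rho_def by (subst nn_integral_add) (auto simp: nn_integral_divide nn_integral_cmult)
  finally show ?thesis .
qed

text \<open>The functional of the overview without the factor \<open>p\<close>.\<close>

definition pairing :: "real \<Rightarrow> lebfun \<Rightarrow> real" where
  "pairing a X = (\<integral>t. brep X t * indicator {0<..<a} t \<partial>nu)"

lemma AE_nu: "AE t in lborel. Q t \<Longrightarrow> AE t in nu. Q t"
  unfolding nu_def by (subst AE_density) (auto elim: eventually_mono)

lemma pairing_integrable:
  assumes a: "a \<in> P" "0 < a" and X: "X \<in> OL_space \<gamma> \<phi> w"
  shows "integrable nu (\<lambda>t. brep X t * indicator {0<..<a} t)"
    and "0 < e \<Longrightarrow> rho (\<lambda>t. brep X t / e) \<le> 1 \<Longrightarrow>
      \<bar>pairing a X\<bar> \<le> enn2real (W (ennreal a) + 1 / ennreal (psi 1)) * e"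
proof -
  define C where "C = W (ennreal a) + 1 / ennreal (psi 1)"
  have psi1: "0 < psi 1" by (simp add: psi_pos)
  have C: "C < \<infinity>"
    using W_finite[OF a(1)] psi1 by (auto simp: C_def ennreal_divide_eq_top_iff less_top[symmetric])
  have bound: "(\<integral>\<^sup>+t. ennreal (norm (brep X t * indicator {0<..<a} t)) \<partial>nu) \<le> ennreal (enn2real C * e)"
    if e: "0 < e" "rho (\<lambda>t. brep X t / e) \<le> 1" for e
  proof -
    have "(\<integral>\<^sup>+t. ennreal (norm (brep X t * indicator {0<..<a} t)) \<partial>nu) =
        (\<integral>\<^sup>+t. ennreal e * (ennreal \<bar>brep X t / e\<bar> * indicator {0<..<a} t) \<partial>nu)"
      using e by (intro nn_integral_cong) (auto simp: indicator_def abs_mult simp flip: ennreal_mult)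
    also have "\<dots> = ennreal e * (\<integral>\<^sup>+t. ennreal \<bar>brep X t / e\<bar> * indicator {0<..<a} t \<partial>nu)"
      by (rule nn_integral_cmult) measurable
    also have "\<dots> \<le> ennreal e * (W (ennreal a) + rho (\<lambda>t. brep X t / e) / ennreal (psi 1))"
      using a by (intro mult_left_mono nn_integral_abs_le) auto
    also have "\<dots> \<le> ennreal e * C"
      unfolding C_def using e by (intro mult_left_mono add_left_mono divide_right_mono_ennreal) auto
    also have "\<dots> = ennreal (enn2real C * e)"
      using C e by (cases C) (auto simp: mult.commute simp flip: ennreal_mult)
    finally show ?thesis .
  qed
  show int: "integrable nu (\<lambda>t. brep X t * indicator {0<..<a} t)"
  proof (rule integrableI_bounded)
    obtain e where "0 < e" "rho (\<lambda>t. brep X t / e) \<le> 1"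
      using OL_norm_set_nonempty[OF X] by auto
    then have "(\<integral>\<^sup>+t. ennreal (norm (brep X t * indicator {0<..<a} t)) \<partial>nu) \<le> ennreal (enn2real C * e)"
      by (rule bound)
    also have "\<dots> < \<infinity>" by simp
    finally show "(\<integral>\<^sup>+t. ennreal (norm (brep X t * indicator {0<..<a} t)) \<partial>nu) < \<infinity>" .
  qed measurable
  assume e: "0 < e" "rho (\<lambda>t. brep X t / e) \<le> 1"
  have "ennreal \<bar>pairing a X\<bar> \<le> (\<integral>\<^sup>+t. ennreal (norm (brep X t * indicator {0<..<a} t)) \<partial>nu)"
    unfolding pairing_def using integral_norm_bound_ennreal[OF int] by simp
  also have "\<dots> \<le> ennreal (enn2real C * e)" by (rule bound[OF e])
  finally show "\<bar>pairing a X\<bar> \<le> enn2real (W (ennreal a) + 1 / ennreal (psi 1)) * e"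
    using e by (simp add: C_def)
qed

lemma pairing_dual:
  assumes a: "a \<in> P" "0 < a"
  shows "pairing a \<in> dual_on (OL_space \<gamma> \<phi> w) (OL_norm \<gamma> \<phi> w)"
  unfolding dual_on_def
proof (intro CollectI conjI ballI allI)
  note int = pairing_integrable(1)[OF a]
  fix X assume X: "X \<in> OL_space \<gamma> \<phi> w"
  show "pairing a (c *\<^sub>R X) = c * pairing a X" for c
  proof -
    have "pairing a (c *\<^sub>R X) = (\<integral>t. c * (brep X t * indicator {0<..<a} t) \<partial>nu)"
      unfolding pairing_def
      using AE_nu[OF brep_scaleR[of c X]] by (intro integral_cong_AE) (auto elim: eventually_mono)
    then show ?thesis by (simp add: pairing_def)
  qed
  fix Y assume Y: "Y \<in> OL_space \<gamma> \<phi> w"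
  have "pairing a (X + Y) =
      (\<integral>t. brep X t * indicator {0<..<a} t + brep Y t * indicator {0<..<a} t \<partial>nu)"
    unfolding pairing_def using AE_nu[OF brep_add[of X Y]]
    by (intro integral_cong_AE) (auto simp: algebra_simps elim: eventually_mono)
  then show "pairing a (X + Y) = pairing a X + pairing a Y"
    using int[OF X] int[OF Y] by (simp add: pairing_def)
next
  \<comment> \<open>The extra 1 makes \<open>C\<close> positive, so that one can divide by it before
    taking the infimum over \<open>e\<close>.\<close>
  define C where "C = enn2real (W (ennreal a) + 1 / ennreal (psi 1)) + 1"
  have C: "0 < C" by (simp add: C_def add_nonneg_pos)
  show "\<exists>C. \<forall>X\<in>OL_space \<gamma> \<phi> w. \<bar>pairing a X\<bar> \<le> C * OL_norm \<gamma> \<phi> w X"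
  proof (intro exI ballI)
    fix X assume X: "X \<in> OL_space \<gamma> \<phi> w"
    have "\<bar>pairing a X\<bar> / C \<le> OL_norm \<gamma> \<phi> w X"
      unfolding OL_norm_eq
    proof (rule cInf_greatest[OF OL_norm_set_nonempty[OF X]])
      fix e assume "e \<in> {e. e > 0 \<and> rho (\<lambda>t. brep X t / e) \<le> 1}"
      then have e: "0 < e" "rho (\<lambda>t. brep X t / e) \<le> 1" by auto
      have "\<bar>pairing a X\<bar> \<le> (C - 1) * e"
        using pairing_integrable(2)[OF a X e] by (simp add: C_def)
      also have "\<dots> \<le> C * e" using e by (simp add: algebra_simps)
      finally show "\<bar>pairing a X\<bar> / C \<le> e" using C by (simp add: divide_le_eq mult.commute)
    qed
    then show "\<bar>pairing a X\<bar> \<le> C * OL_norm \<gamma> \<phi> w X"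
      using C by (simp add: divide_le_eq mult.commute)
  qed
qed

end

section \<open>The defect inequality\<close>

text \<open>\<open>below_u\<close> and \<open>above_u\<close> say that a line of slope
  \<open>p\<close> touches the graph of \<phi> only at \<open>u\<close>. They leave
  \<open>psi u\<close> itself open, hence the exception for the level \<open>u\<close> from here on.
  \<open>normalised\<close> gives the center modular 1.\<close>

locale exposed = orlicz_lorentz +
  fixes u p a V :: real
  assumes u_pos: "0 < u" and p_pos: "0 < p"
    and below_u: "l < u \<Longrightarrow> psi l < p" and above_u: "u < l \<Longrightarrow> p < psi l"
    and a_in_P: "a \<in> P" and V_nonneg: "0 \<le> V" and W_a: "W (ennreal a) = ennreal V"
    and normalised: "V * \<phi> u = 1"
begin

lemma a_pos: "0 < a"
  using a_in_P by (simp add: P_def)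

lemma V_pos: "0 < V"
  using V_nonneg normalised by (cases "V = 0") auto

lemma nu_A: "emeasure nu {0<..<a} = ennreal V"
proof -
  have "emeasure nu ({0<..<a} \<inter> P) = emeasure nu ({..<a} \<inter> P)"
    by (rule arg_cong[where f = "emeasure nu"]) (auto simp: P_def)
  then show ?thesis using W_a W_ennreal[OF a_pos] by (simp add: emeasure_nu_P)
qed

text \<open>The pairing is signed, so the level sets use \<open>y\<close> and not its absolute
  value. Integrated over positive levels, \<open>h y\<close> gives the pairing of the positive part
  of \<open>y\<close>.\<close>

definition h :: "(real \<Rightarrow> real) \<Rightarrow> real \<Rightarrow> ennreal" where
  "h y l = emeasure nu ({0<..<a} \<inter> {t. l < y t})"

text \<open>The slice condition, weakened by dropping the negative part of \<open>y\<close> and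
  arranged so that nothing is subtracted in \<open>ennreal\<close>.\<close>

definition almost_norming :: "(real \<Rightarrow> real) \<Rightarrow> real \<Rightarrow> bool" where
  "almost_norming y e \<longleftrightarrow> y \<in> borel_measurable borel \<and> 0 < e \<and> rho y \<le> 1 \<and>
     ennreal (p * (u * V)) \<le> ennreal p * (\<integral>\<^sup>+l. h y l * indicator {0<..} l \<partial>lborel) + ennreal e"

text \<open>The integrand of the defect in the chain of inequalities
  \<open>p * pairing a y \<le> p * \<integral>h \<le> p * u * V\<close>; both summands are nonnegative on either side of \<open>u\<close>.\<close>

definition defect :: "(real \<Rightarrow> real) \<Rightarrow> real \<Rightarrow> ennreal" where
  "defect y l =
    (if l \<le> 0 \<or> l = u then 0
     else (W (dis y l) - h y l) * Psi l +
       (if l < u then ennreal ((V - enn2real (h y l)) * (p - psi l))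
        else ennreal (enn2real (h y l) * (psi l - p))))"

lemma h_le_V: "h y l \<le> ennreal V"
  unfolding h_def nu_A[symmetric] by (intro nu_mono) auto

lemma h_eq: "h y l = ennreal (enn2real (h y l))"
  using le_less_trans[OF h_le_V[of y l] ennreal_less_top] by simp

lemma h_real_le_V: "enn2real (h y l) \<le> V"
  by (rule enn2real_leI[OF V_nonneg h_le_V])

lemma h_le_W: "y \<in> borel_measurable borel \<Longrightarrow> h y l \<le> W (dis y l)"
  unfolding h_def by (intro nu_level_le) auto

lemma A_level_borel:
  fixes y :: "real \<Rightarrow> real"
  assumes [measurable]: "y \<in> borel_measurable borel"
  shows "{0<..<a} \<inter> {t. l < y t} \<in> sets borel"
proof -
  have "{t \<in> space borel. t \<in> {0<..<a} \<and> l < y t} \<in> sets borel" by measurable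
  then show ?thesis by (simp add: Int_def)
qed

lemma h_antimono: "y \<in> borel_measurable borel \<Longrightarrow> l \<le> l' \<Longrightarrow> h y l' \<le> h y l"
  unfolding h_def by (intro nu_mono A_level_borel) auto

lemma h_real_antimono: "y \<in> borel_measurable borel \<Longrightarrow> l \<le> l' \<Longrightarrow> enn2real (h y l') \<le> enn2real (h y l)"
  using h_antimono[of y l l'] h_le_V[of y l] by (intro enn2real_mono) (auto intro: le_less_trans)

lemma h_measurable [measurable (raw)]:
  assumes "y \<in> borel_measurable borel" "f \<in> borel_measurable M"
  shows "(\<lambda>x. h y (f x)) \<in> borel_measurable M"
proof -
  have "h y \<in> borel_measurable borel"
    by (intro antimono_borel_measurable_ennreal antimonoI h_antimono assms)
  from measurable_compose[OF assms(2) this] show ?thesis .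
qed

lemma defect_measurable [measurable]:
  assumes [measurable]: "y \<in> borel_measurable borel"
  shows "defect y \<in> borel_measurable borel"
  unfolding defect_def[abs_def] by measurable

text \<open>Integrated over \<open>l\<close>, this says that the total defect plus \<open>p\<close>
  times the integral of \<open>h\<close> plus \<open>V * \<phi> u\<close> equals
  \<open>p * V * u + rho y\<close>. Terms are moved so that both sides are sums of nonnegative
  ones.\<close>

lemma defect_identity:
  assumes y: "y \<in> borel_measurable borel" and l: "l \<noteq> u"
  shows "defect y l + ennreal p * (h y l * indicator {0<..} l) + ennreal V * (Psi l * indicator {..<u} l)
    = ennreal (p * V) * indicator {0<..<u} l + W (dis y l) * Psi l"
proof -
  define r where "r = enn2real (h y l)"
  have hr: "h y l = ennreal r" "0 \<le> r" "r \<le> V"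
    using h_eq[of y l] h_real_le_V[of y l] by (auto simp: r_def)
  \<comment> \<open>The truncated subtraction is exact because \<open>h y l\<close> is at most
    \<open>W (dis y l)\<close>.\<close>
  have split: "W (dis y l) * Psi l = (W (dis y l) - h y l) * Psi l + h y l * Psi l"
    using h_le_W[OF y, of l] by (simp add: distrib_right[symmetric] diff_add_cancel_ennreal)
  consider "l \<le> 0" | "0 < l" "l < u" | "u < l" using l by linarith
  then show ?thesis
  proof cases
    case 1
    then show ?thesis by (simp add: defect_def)
  next
    case 2
    have "(V - r) * (p - psi l) + p * r + V * psi l = p * V + r * psi l"
      by (simp add: algebra_simps)
    moreover have "0 \<le> (V - r) * (p - psi l)"
      using hr below_u[OF 2(2)] by (intro mult_nonneg_nonneg) auto
    ultimately have "ennreal ((V - r) * (p - psi l)) + ennreal p * ennreal r + ennreal V * Psi l =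
        ennreal (p * V) + ennreal r * Psi l"
      using hr V_pos p_pos by (simp flip: ennreal_plus ennreal_mult)
    then show ?thesis
      using 2 hr unfolding split by (simp add: defect_def add.assoc add.left_commute add.commute)
  next
    case 3
    have "r * (psi l - p) + p * r = r * psi l" by (simp add: algebra_simps)
    moreover have "0 \<le> r * (psi l - p)"
      using hr above_u[OF 3] by (intro mult_nonneg_nonneg) auto
    ultimately have "ennreal (r * (psi l - p)) + ennreal p * ennreal r = ennreal r * Psi l"
      using hr V_pos p_pos by (simp flip: ennreal_plus ennreal_mult)
    then show ?thesis
      using 3 hr u_pos unfolding split by (simp add: defect_def add.assoc)
  qed
qed

text \<open>In the integrated identity \<open>V * \<phi> u = 1\<close> absorbs
  \<open>rho y <= 1\<close>; the remaining defect is at most the loss in the functional.\<close>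

lemma nn_integral_defect_le:
  assumes "almost_norming y e"
  shows "(\<integral>\<^sup>+l. defect y l \<partial>lborel) \<le> ennreal e"
proof -
  have [measurable]: "y \<in> borel_measurable borel" and e: "0 < e" and rho: "rho y \<le> 1"
    and norming: "ennreal (p * (u * V)) \<le> ennreal p * (\<integral>\<^sup>+l. h y l * indicator {0<..} l \<partial>lborel) + ennreal e"
    using assms by (auto simp: almost_norming_def)
  define H where "H = (\<integral>\<^sup>+l. h y l * indicator {0<..} l \<partial>lborel)"
  define D where "D = (\<integral>\<^sup>+l. defect y l \<partial>lborel)"
  have "(\<integral>\<^sup>+l. defect y l + ennreal p * (h y l * indicator {0<..} l) +
        ennreal V * (Psi l * indicator {..<u} l) \<partial>lborel) =
      (\<integral>\<^sup>+l. ennreal (p * V) * indicator {0<..<u} l + W (dis y l) * Psi l \<partial>lborel)"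
    using AE_lborel_singleton[of u]
    by (intro nn_integral_cong_AE) (auto elim!: eventually_mono simp: defect_identity)
  moreover have "(\<integral>\<^sup>+l. defect y l + ennreal p * (h y l * indicator {0<..} l) +
        ennreal V * (Psi l * indicator {..<u} l) \<partial>lborel) = D + ennreal p * H + ennreal V * ennreal (\<phi> u)"
    using u_pos unfolding D_def H_def
    by (simp add: nn_integral_add nn_integral_cmult nn_integral_psi_lessThan)
  moreover have "(\<integral>\<^sup>+l. ennreal (p * V) * indicator {0<..<u} l + W (dis y l) * Psi l \<partial>lborel) =
      ennreal (p * V) * ennreal u + rho y"
    using u_pos unfolding rho_def by (simp add: nn_integral_add nn_integral_cmult)
  moreover have "ennreal V * ennreal (\<phi> u) = 1"
    using normalised V_nonneg by (simp flip: ennreal_mult')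
  ultimately have "D + ennreal p * H + 1 = ennreal (p * V) * ennreal u + rho y" by simp
  also have "\<dots> \<le> ennreal (p * (u * V)) + 1"
    using rho p_pos V_pos u_pos by (simp add: mult_ac flip: ennreal_mult)
  finally have le: "D + ennreal p * H \<le> ennreal (p * (u * V))"
    by (simp add: ennreal_add_left_cancel_le add.commute[of _ 1])
  \<comment> \<open>Finiteness of \<open>ennreal p * H\<close> is what permits its cancellation
    below.\<close>
  have "ennreal p * H \<le> D + ennreal p * H" by (simp add: add_increasing)
  also note le
  also have "ennreal (p * (u * V)) < \<infinity>" by simp
  finally have fin: "ennreal p * H \<noteq> \<infinity>" by simp
  have "ennreal p * H + D \<le> ennreal p * H + ennreal e"
    using order_trans[OF le norming[folded H_def]] by (simp add: add.commute)
  then show ?thesis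
    using fin by (simp add: D_def ennreal_add_left_cancel_le)
qed

section \<open>What a small defect controls on each range of levels\<close>

lemma defect_lower_bound:
  assumes y: "almost_norming y e" and S: "S \<in> sets lborel"
    and f: "\<And>l. l \<in> S \<Longrightarrow> l \<noteq> u \<Longrightarrow> f l \<le> defect y l"
  shows "(\<integral>\<^sup>+l. f l * indicator S l \<partial>lborel) \<le> ennreal e"
proof -
  have "(\<integral>\<^sup>+l. f l * indicator S l \<partial>lborel) \<le> (\<integral>\<^sup>+l. defect y l \<partial>lborel)"
    using AE_lborel_singleton[of u]
    by (intro nn_integral_mono_AE) (auto elim!: eventually_mono simp: indicator_def f)
  also have "\<dots> \<le> ennreal e" by (rule nn_integral_defect_le[OF y])
  finally show ?thesis .
qed

lemma defect_lower_bound_const: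
  assumes y: "almost_norming y e" and "r \<le> s" and k: "0 \<le> k"
    and f: "\<And>l. r < l \<Longrightarrow> l < s \<Longrightarrow> l \<noteq> u \<Longrightarrow> ennreal k \<le> defect y l"
  shows "k * (s - r) \<le> e"
proof -
  have "(\<integral>\<^sup>+l. ennreal k * indicator {r<..<s} l \<partial>lborel) \<le> ennreal e"
    using f by (intro defect_lower_bound[OF y]) auto
  moreover have "(\<integral>\<^sup>+l. ennreal k * indicator {r<..<s} l \<partial>lborel) = ennreal (k * (s - r))"
    using assms by (simp add: nn_integral_cmult ennreal_mult)
  ultimately show ?thesis
    using y by (simp add: almost_norming_def)
qed

text \<open>A shortage of mass at level \<open>u - d\<close> persists at higher levels. It is tested
  only up to \<open>u - d / 2\<close>, where \<open>p - psi l\<close> is still bounded away from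
  0.\<close>

lemma h_below:
  assumes y: "almost_norming y e" and d: "0 < d" "d \<le> u"
  shows "(V - enn2real (h y (u - d))) * ((p - psi (u - d / 2)) * (d / 2)) \<le> e"
proof -
  have [measurable]: "y \<in> borel_measurable borel" using y by (simp add: almost_norming_def)
  have "(V - enn2real (h y (u - d))) * (p - psi (u - d / 2)) * ((u - d / 2) - (u - d)) \<le> e"
  proof (rule defect_lower_bound_const[OF y])
    show "0 \<le> (V - enn2real (h y (u - d))) * (p - psi (u - d / 2))"
      using h_real_le_V[of y] below_u[of "u - d / 2"] d by (intro mult_nonneg_nonneg) auto
    fix l assume l: "u - d < l" "l < u - d / 2"
    have "(V - enn2real (h y (u - d))) * (p - psi (u - d / 2)) \<le> (V - enn2real (h y l)) * (p - psi l)"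
      using h_real_le_V[of y] below_u[of "u - d / 2"] d l h_real_antimono[of y "u - d" l] psi_mono[of l "u - d / 2"]
      by (intro mult_mono) auto
    then show "ennreal ((V - enn2real (h y (u - d))) * (p - psi (u - d / 2))) \<le> defect y l"
      using l d by (auto simp: defect_def intro!: add_increasing ennreal_leI)
  qed (use d in auto)
  then show ?thesis by (simp add: mult.assoc)
qed

text \<open>Mirror image: an excess at \<open>u + d\<close> is already present at lower levels,
  tested from \<open>u + d / 2\<close> on.\<close>

lemma h_above:
  assumes y: "almost_norming y e" and d: "0 < d"
  shows "enn2real (h y (u + d)) * ((psi (u + d / 2) - p) * (d / 2)) \<le> e"
proof -
  have [measurable]: "y \<in> borel_measurable borel" using y by (simp add: almost_norming_def)
  have "enn2real (h y (u + d)) * (psi (u + d / 2) - p) * ((u + d) - (u + d / 2)) \<le> e"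
  proof (rule defect_lower_bound_const[OF y])
    show "0 \<le> enn2real (h y (u + d)) * (psi (u + d / 2) - p)"
      using above_u[of "u + d / 2"] d by (intro mult_nonneg_nonneg) auto
    fix l assume l: "u + d / 2 < l" "l < u + d"
    have "enn2real (h y (u + d)) * (psi (u + d / 2) - p) \<le> enn2real (h y l) * (psi l - p)"
      using above_u[of "u + d / 2"] d l h_real_antimono[of y l "u + d"] psi_mono[of "u + d / 2" l]
      by (intro mult_mono) auto
    then show "ennreal (enn2real (h y (u + d)) * (psi (u + d / 2) - p)) \<le> defect y l"
      using l d u_pos by (auto simp: defect_def intro!: add_increasing ennreal_leI)
  qed (use d in auto)
  then show ?thesis by (simp add: mult.assoc)
qed

text \<open>An excess \<open>k\<close> over \<open>V\<close> is present on all levels from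
  \<open>d / 2\<close> to \<open>d\<close>. Since \<open>h\<close> is at most \<open>V\<close>, the
  first summand of the defect is there at least \<open>k * psi (d / 2)\<close>.\<close>

lemma W_dis_le:
  assumes y: "almost_norming y e" and d: "0 < d" and k: "0 \<le> k" "ennreal (V + k) \<le> W (dis y d)"
  shows "k * (psi (d / 2) * (d / 2)) \<le> e"
proof -
  have [measurable]: "y \<in> borel_measurable borel" using y by (simp add: almost_norming_def)
  have "k * psi (d / 2) * (d - d / 2) \<le> e"
  proof (rule defect_lower_bound_const[OF y])
    fix l assume l: "d / 2 < l" "l < d" "l \<noteq> u"
    have "ennreal k + ennreal V \<le> W (dis y d)"
      using k V_nonneg by (simp add: add.commute flip: ennreal_plus)
    also have "\<dots> \<le> W (dis y l)"
      using l by (intro W_mono antimonoD[OF dis_antimono]) auto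
    finally have "ennreal k \<le> W (dis y l) - ennreal V"
      by (simp add: ennreal_le_minus_iff)
    also have "\<dots> \<le> W (dis y l) - h y l"
      by (intro ennreal_minus_mono h_le_V order_refl)
    finally have "ennreal k * Psi (d / 2) \<le> (W (dis y l) - h y l) * Psi l"
      using l by (intro mult_mono ennreal_leI psi_mono) auto
    then show "ennreal (k * psi (d / 2)) \<le> defect y l"
      using l d k by (auto simp: defect_def ennreal_mult intro!: add_increasing2)
  qed (use d k in auto)
  then show ?thesis by (simp add: mult.assoc)
qed

text \<open>From level \<open>L\<close> on the defect dominates a fixed fraction of the integrand of
  the modular: \<open>psi l >= psi L\<close> gives \<open>psi l - p >= k * psi l\<close> with
  \<open>k = 1 - p / psi L\<close>.\<close>

lemma nn_integral_tail_le:
  assumes y: "almost_norming y e" and L: "u < L"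
  shows "(\<integral>\<^sup>+l. W (dis y l) * Psi l * indicator {L..} l \<partial>lborel) \<le> ennreal (e / (1 - p / psi L))"
proof -
  have [measurable]: "y \<in> borel_measurable borel" and e: "0 < e"
    using y by (auto simp: almost_norming_def)
  define k where "k = 1 - p / psi L"
  have psiL: "p < psi L" using above_u[OF L] .
  then have k: "0 < k" "k \<le> 1" using p_pos by (auto simp: k_def)
  have "ennreal k * (\<integral>\<^sup>+l. W (dis y l) * Psi l * indicator {L..} l \<partial>lborel) =
      (\<integral>\<^sup>+l. ennreal k * (W (dis y l) * Psi l) * indicator {L..} l \<partial>lborel)"
    by (subst nn_integral_cmult[symmetric]) (auto simp: mult.assoc)
  also have "\<dots> \<le> ennreal e"
  proof (rule defect_lower_bound[OF y])
    fix l assume "l \<in> {L..}"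
    then have l: "L \<le> l" by simp
    define r where "r = enn2real (h y l)"
    have hr: "h y l = ennreal r" "0 \<le> r" using h_eq[of y l] by (auto simp: r_def)
    have "p * 1 \<le> p * (psi l / psi L)"
      using psi_mono[OF l] psiL p_pos by (intro mult_left_mono) auto
    then have "k * psi l \<le> psi l - p" by (simp add: k_def algebra_simps)
    then have "r * (k * psi l) \<le> r * (psi l - p)" using hr by (intro mult_left_mono)
    then have "ennreal (r * (k * psi l)) \<le> ennreal (r * (psi l - p))" by (rule ennreal_leI)
    moreover have "ennreal k * (h y l * Psi l) = ennreal (r * (k * psi l))"
      using hr k by (simp add: mult_ac flip: ennreal_mult)
    ultimately have 1: "ennreal k * (h y l * Psi l) \<le> ennreal (r * (psi l - p))" by simp
    have 2: "ennreal k * ((W (dis y l) - h y l) * Psi l) \<le> 1 * ((W (dis y l) - h y l) * Psi l)"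
      using k by (intro mult_right_mono) auto
    have "ennreal k * (W (dis y l) * Psi l) =
        ennreal k * ((W (dis y l) - h y l) * Psi l) + ennreal k * (h y l * Psi l)"
      using h_le_W[of y l] by (simp add: diff_add_cancel_ennreal flip: distrib_left distrib_right)
    also have "\<dots> \<le> defect y l"
      using add_mono[OF 2 1] l L u_pos by (simp add: defect_def r_def)
    finally show "ennreal k * (W (dis y l) * Psi l) \<le> defect y l" .
  qed simp
  finally have *: "ennreal k * (\<integral>\<^sup>+l. W (dis y l) * Psi l * indicator {L..} l \<partial>lborel) \<le> ennreal e" .
  have "(\<integral>\<^sup>+l. W (dis y l) * Psi l * indicator {L..} l \<partial>lborel) =
      ennreal (1 / k) * (ennreal k * (\<integral>\<^sup>+l. W (dis y l) * Psi l * indicator {L..} l \<partial>lborel))"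
    using k by (simp add: mult.assoc[symmetric] flip: ennreal_mult)
  also have "\<dots> \<le> ennreal (1 / k) * ennreal e" using * by (rule mult_left_mono) simp
  also have "\<dots> = ennreal (e / k)" using k e by (simp flip: ennreal_mult)
  finally show ?thesis unfolding k_def .
qed

text \<open>Below \<open>u\<close> the defect does not bound the share \<open>h * psi\<close> of the
  modular. That share is at most \<open>V * psi u\<close> per level, so a short range of levels
  keeps it small.\<close>

lemma nn_integral_head_le:
  assumes y: "almost_norming y e" and d: "0 < d" "d \<le> u"
  shows "(\<integral>\<^sup>+l. W (dis y l) * Psi l * indicator {..<d} l \<partial>lborel) \<le> ennreal (e + V * psi u * d)"
proof -
  have [measurable]: "y \<in> borel_measurable borel" and e: "0 < e"
    using y by (auto simp: almost_norming_def)
  have "(\<integral>\<^sup>+l. W (dis y l) * Psi l * indicator {..<d} l \<partial>lborel) \<le>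
      (\<integral>\<^sup>+l. defect y l + ennreal (V * psi u) * indicator {0..d} l \<partial>lborel)"
  proof (rule nn_integral_mono)
    fix l
    show "W (dis y l) * Psi l * indicator {..<d} l \<le> defect y l + ennreal (V * psi u) * indicator {0..d} l"
    proof (cases "0 < l \<and> l < d")
      case True
      then have l: "0 < l" "l < d" "l < u" using d by auto
      have "W (dis y l) * Psi l = (W (dis y l) - h y l) * Psi l + h y l * Psi l"
        using h_le_W[of y l] by (simp add: distrib_right[symmetric] diff_add_cancel_ennreal)
      also have "\<dots> \<le> defect y l + ennreal V * Psi u"
      proof (rule add_mono)
        show "(W (dis y l) - h y l) * Psi l \<le> defect y l" using l by (simp add: defect_def)
        show "h y l * Psi l \<le> ennreal V * Psi u"
          using l h_le_V by (intro mult_mono ennreal_leI psi_mono) auto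
      qed
      finally show ?thesis using l V_nonneg by (simp add: ennreal_mult)
    qed auto
  qed
  also have "\<dots> = (\<integral>\<^sup>+l. defect y l \<partial>lborel) + ennreal (V * psi u) * ennreal d"
    using d by (simp add: nn_integral_add nn_integral_cmult)
  also have "\<dots> \<le> ennreal e + ennreal (V * psi u) * ennreal d"
    by (intro add_right_mono nn_integral_defect_le[OF y])
  also have "\<dots> = ennreal (e + V * psi u * d)"
    using e V_nonneg d by (simp flip: ennreal_mult)
  finally show ?thesis .
qed

end

section \<open>A small defect forces modular closeness\<close>

lemma ennreal_le_divide_if_mult_le:
  assumes "0 < k" "ennreal k * m \<le> ennreal r"
  shows "m \<le> ennreal (r / k)"
proof (cases m)
  case (real q)
  then have "k * q \<le> r \<or> k * q \<le> 0"
    using assms by (cases "0 \<le> r") (auto simp: ennreal_neg simp flip: ennreal_mult)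
  then show ?thesis
  proof
    assume "k * q \<le> r"
    then show ?thesis using assms(1) real by (simp add: pos_le_divide_eq mult.commute ennreal_leI)
  next
    assume "k * q \<le> 0"
    then have "q = 0" using assms(1) real by (simp add: mult_le_0_iff)
    then show ?thesis using real by simp
  qed
next
  case top
  then show ?thesis using assms by (simp add: ennreal_mult_top top_unique)
qed

text \<open>For reading off constants; adding 1 to \<open>C\<close> keeps the denominator positive
  when \<open>C = 0\<close>.\<close>

lemma mult_le_if_le_divide:
  fixes c C d k :: real
  assumes "0 < c" "0 \<le> C" "0 \<le> d" "0 < k" and d: "d \<le> 1 / (k * c * (C + 1))"
  shows "c * (C * d) \<le> 1 / k"
proof -
  have "d * (k * c * (C + 1)) \<le> 1"
    using d assms by (subst (asm) pos_le_divide_eq) auto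
  moreover have "0 \<le> d * (k * c)" using assms by simp
  ultimately have "c * (C * d) * k \<le> 1" by (simp add: algebra_simps)
  then show ?thesis using assms by (simp add: pos_le_divide_eq)
qed

context exposed
begin

definition center :: "real \<Rightarrow> real" where "center t = u * indicator {0<..<a} t"

lemma center_measurable [measurable]: "center \<in> borel_measurable borel"
  unfolding center_def[abs_def] by measurable

lemma center_cases: "0 < t \<Longrightarrow> t < a \<Longrightarrow> center t = u" "a \<le> t \<Longrightarrow> center t = 0"
  by (auto simp: center_def)

lemma emeasure_A: "emeasure lborel {0<..<a} = ennreal a"
  using a_pos by simp

text \<open>\<open>h_below\<close> bounds the shortage in \<open>nu\<close>; the density is at least
  \<open>w a\<close> on (0,a), which converts it to Lebesgue measure.\<close>

lemma below_mass:
  assumes y: "almost_norming y e" and d: "0 < d" "d \<le> u"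
  shows "emeasure lborel ({0<..<a} \<inter> {t. y t \<le> u - d})
    \<le> ennreal (e / ((p - psi (u - d / 2)) * (d / 2)) / w a)"
proof -
  have [measurable]: "y \<in> borel_measurable borel" using y by (simp add: almost_norming_def)
  let ?B = "{0<..<a} \<inter> {t. y t \<le> u - d}"
  define c where "c = (p - psi (u - d / 2)) * (d / 2)"
  have c: "0 < c" using below_u[of "u - d / 2"] d by (simp add: c_def)
  define r where "r = enn2real (h y (u - d))"
  have r: "0 \<le> r" "r \<le> V" "h y (u - d) = ennreal r"
    using h_real_le_V[of y "u - d"] h_eq[of y "u - d"] by (auto simp: r_def)
  have "{t \<in> space borel. t \<in> {0<..<a} \<and> y t \<le> u - d} \<in> sets borel" by measurable
  then have B [measurable]: "?B \<in> sets borel" by (simp add: Int_def)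
  have eq: "{0<..<a} - ({0<..<a} \<inter> {t. u - d < y t}) = ?B" by auto
  have "ennreal V = h y (u - d) + emeasure nu ?B"
    using nu_split[OF _ A_level_borel[of y "u - d"], of "{0<..<a}"]
    by (simp add: nu_A h_def eq)
  then have "ennreal r + emeasure nu ?B = ennreal r + ennreal (V - r)"
    using r by (simp flip: ennreal_plus)
  then have "emeasure nu ?B = ennreal (V - r)"
    by (simp add: ennreal_add_left_cancel)
  moreover have "V - r \<le> e / c"
    using h_below[OF y d, folded c_def r_def] c by (simp add: pos_le_divide_eq)
  ultimately have "emeasure nu ?B \<le> ennreal (e / c)" by (simp add: ennreal_leI)
  moreover have "ennreal (w a) * emeasure lborel ?B \<le> emeasure nu ?B"
    using a_in_P by (intro nu_ge) auto
  ultimately have "ennreal (w a) * emeasure lborel ?B \<le> ennreal (e / c)" by simp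
  then show ?thesis
    unfolding c_def[symmetric] using w_pos[OF a_in_P] by (rule ennreal_le_divide_if_mult_le[rotated])
qed

lemma above_mass:
  assumes y: "almost_norming y e" and d: "0 < d"
  shows "emeasure lborel ({0<..<a} \<inter> {t. u + d < y t})
    \<le> ennreal (e / ((psi (u + d / 2) - p) * (d / 2)) / w a)"
proof -
  have [measurable]: "y \<in> borel_measurable borel" using y by (simp add: almost_norming_def)
  define c where "c = (psi (u + d / 2) - p) * (d / 2)"
  have c: "0 < c" using above_u[of "u + d / 2"] d by (simp add: c_def)
  have "ennreal (w a) * emeasure lborel ({0<..<a} \<inter> {t. u + d < y t}) \<le> h y (u + d)"
    unfolding h_def using a_in_P by (intro nu_ge A_level_borel) auto
  also have "\<dots> = ennreal (enn2real (h y (u + d)))" by (rule h_eq)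
  also have "\<dots> \<le> ennreal (e / c)"
    using h_above[OF y d, folded c_def] c by (intro ennreal_leI) (simp add: pos_le_divide_eq)
  finally show ?thesis
    unfolding c_def[symmetric] using w_pos[OF a_in_P] by (rule ennreal_le_divide_if_mult_le[rotated])
qed

text \<open>A level set longer than \<open>a + k\<close> would have \<open>W\<close> at least
  \<open>V + k * w (a + k)\<close>, which \<open>W_dis_le\<close> excludes for so small an
  \<open>e\<close>.\<close>

lemma total_mass:
  assumes y: "almost_norming y e" and d: "0 < d" and k: "0 < k" "a + k \<in> P"
    and e: "e < k * w (a + k) * (psi (d / 2) * (d / 2))"
  shows "dis y d \<le> ennreal (a + k)"
proof (rule ccontr)
  assume "\<not> dis y d \<le> ennreal (a + k)"
  then have "W (ennreal (a + k)) \<le> W (dis y d)" by (intro W_mono) simp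
  moreover have "ennreal (V + k * w (a + k)) \<le> W (ennreal (a + k))"
  proof -
    have "ennreal (w (a + k)) * ennreal k = ennreal (w (a + k)) * emeasure lborel {a..<a + k}"
      using k by simp
    also have "\<dots> \<le> emeasure nu {a..<a + k}"
      using k a_pos by (intro nu_ge) auto
    finally have 1: "ennreal (k * w (a + k)) \<le> emeasure nu {a..<a + k}"
      using k w_pos[OF k(2)] by (simp add: mult.commute flip: ennreal_mult)
    have "W (ennreal (a + k)) = emeasure nu ({..<a + k} \<inter> {..<a}) + emeasure nu ({..<a + k} - {..<a})"
      using k a_pos W_ennreal[of "a + k"] nu_split[of "{..<a + k}" "{..<a}"] by simp
    also have "{..<a + k} \<inter> {..<a} = {..<a}" using k by auto
    also have "emeasure nu {..<a} = ennreal V" using W_a W_ennreal[OF a_pos] by simp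
    also have "{..<a + k} - {..<a} = {a..<a + k}" by auto
    finally show ?thesis
      using 1 V_nonneg k w_pos[OF k(2)] by (simp add: add_left_mono)
  qed
  ultimately have "k * w (a + k) * (psi (d / 2) * (d / 2)) \<le> e"
    using k w_pos[OF k(2)] by (intro W_dis_le[OF y d]) auto
  with e show False by simp
qed

text \<open>\<open>y\<close> can be far from the center by being too low (\<open>B1\<close>) or too
  high (\<open>B2\<close>) on (0,a), or large beyond \<open>a\<close> (\<open>B3\<close>). Only the
  total length of the level set of \<open>y\<close> is controlled; \<open>B3\<close> is small
  because (0,a) minus \<open>B1\<close> already uses up almost all of that length.\<close>

lemma center_in_measure:
  assumes d: "0 < d" "2 * d < u" and \<theta>: "0 < \<theta>"
  obtains e0 where "0 < e0"
    "\<And>y e. almost_norming y e \<Longrightarrow> e \<le> e0 \<Longrightarrow> dis (\<lambda>t. y t - center t) d \<le> ennreal \<theta>"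
proof -
  have "ereal a < \<gamma>" using a_in_P by (simp add: P_def)
  then obtain b where b: "a < b" "ereal b < \<gamma>"
    using ereal_dense2[of "ereal a" \<gamma>] by auto
  \<comment> \<open>Small enough for the final count and for \<open>a + k\<close> to stay below
    \<gamma>, where \<open>w\<close> is positive.\<close>
  define k where "k = min (\<theta> / 4) (b - a)"
  have k: "0 < k" "k \<le> \<theta> / 4" using \<theta> b by (simp_all add: k_def min.cobounded1 del: le_divide_eq_numeral1)
  have "a + k \<le> b" by (simp add: k_def)
  then have akP: "a + k \<in> P"
    using b a_pos k by (auto simp: P_def intro: le_less_trans[of _ "ereal b"])
  define c1 where "c1 = (p - psi (u - d / 2)) * (d / 2)"
  define c2 where "c2 = (psi (u + d / 2) - p) * (d / 2)"
  define c3 where "c3 = k * w (a + k) * (psi (d / 2) * (d / 2))"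
  have c: "0 < c1" "0 < c2" "0 < c3"
    using below_u[of "u - d / 2"] above_u[of "u + d / 2"] d k w_pos[OF akP] psi_pos[of "d / 2"]
    by (auto simp: c1_def c2_def c3_def)
  have wa: "0 < w a" by (rule w_pos[OF a_in_P])
  define e0 where "e0 = Min {c1 * w a * (\<theta> / 4), c2 * w a * (\<theta> / 4), c3 / 2}"
  show thesis
  proof (rule that)
    show "0 < e0" using c wa \<theta> by (simp add: e0_def)
    fix y e assume y: "almost_norming y e" and e: "e \<le> e0"
    have [measurable]: "y \<in> borel_measurable borel" using y by (simp add: almost_norming_def)
    define B1 where "B1 = {0<..<a} \<inter> {t. y t \<le> u - d}"
    define B2 where "B2 = {0<..<a} \<inter> {t. u + d < y t}"
    define B3 where "B3 = {t \<in> P. a \<le> t \<and> d < \<bar>y t\<bar>}"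
    define G where "G = {t \<in> {0<..<a}. d < \<bar>y t\<bar>}"
    have "{t \<in> space borel. t \<in> {0<..<a} \<and> y t \<le> u - d} \<in> sets borel"
      "{t \<in> space borel. t \<in> {0<..<a} \<and> u + d < y t} \<in> sets borel"
      "{t \<in> space borel. t \<in> P \<and> a \<le> t \<and> d < \<bar>y t\<bar>} \<in> sets borel"
      "{t \<in> space borel. t \<in> {0<..<a} \<and> d < \<bar>y t\<bar>} \<in> sets borel"
      by measurable
    then have B [measurable]: "B1 \<in> sets borel" "B2 \<in> sets borel" "B3 \<in> sets borel" "G \<in> sets borel"
      by (simp_all add: B1_def B2_def B3_def G_def Int_def)
    have m1: "emeasure lborel B1 \<le> ennreal (\<theta> / 4)"
    proof -
      have "e / c1 / w a \<le> \<theta> / 4" using e c wa by (simp add: e0_def field_simps)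
      from ennreal_leI[OF this] show ?thesis
        using below_mass[OF y d(1), folded B1_def c1_def] d order_trans by fastforce
    qed
    have m2: "emeasure lborel B2 \<le> ennreal (\<theta> / 4)"
    proof -
      have "e / c2 / w a \<le> \<theta> / 4" using e c wa by (simp add: e0_def field_simps)
      from ennreal_leI[OF this] show ?thesis
        by (rule order_trans[OF above_mass[OF y d(1), folded B2_def c2_def]])
    qed
    have m3: "emeasure lborel B3 \<le> ennreal k + emeasure lborel B1"
    proof -
      have GA: "emeasure lborel G \<le> ennreal a"
        unfolding emeasure_A[symmetric] by (intro emeasure_mono) (auto simp: G_def)
      have "emeasure lborel G + emeasure lborel B3 = emeasure lborel (G \<union> B3)"
        by (intro plus_emeasure) (auto simp: G_def B3_def)
      also have "\<dots> = dis y d"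
        unfolding dis_def using P_downward[OF a_in_P]
        by (intro arg_cong[where f = "emeasure lborel"]) (auto simp: G_def B3_def P_def)
      also have "\<dots> \<le> ennreal (a + k)"
        using e c by (intro total_mass[OF y d(1) k(1) akP, folded c3_def]) (auto simp: e0_def)
      also have "\<dots> = emeasure lborel {0<..<a} + ennreal k"
        using a_pos k by (simp add: emeasure_A)
      \<comment> \<open>\<open>2 * d < u\<close> gives \<open>u - d > d\<close>, so points of (0,a)
        outside \<open>B1\<close> lie in \<open>G\<close>.\<close>
      also have "emeasure lborel {0<..<a} \<le> emeasure lborel (G \<union> B1)"
        using d by (intro emeasure_mono) (auto simp: G_def B1_def)
      also have "\<dots> \<le> emeasure lborel G + emeasure lborel B1"
        by (intro emeasure_subadditive) auto
      finally have "emeasure lborel G + emeasure lborel B3 \<le>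
          emeasure lborel G + (ennreal k + emeasure lborel B1)"
        by (simp add: add_right_mono add_ac)
      moreover have "emeasure lborel G \<noteq> top"
        using le_less_trans[OF GA ennreal_less_top] by simp
      ultimately show ?thesis by (simp add: ennreal_add_left_cancel_le)
    qed
    have "{t \<in> P. d < \<bar>y t - center t\<bar>} \<subseteq> B1 \<union> B2 \<union> B3"
    proof
      fix t assume t: "t \<in> {t \<in> P. d < \<bar>y t - center t\<bar>}"
      then have "0 < t" by (simp add: P_def)
      then show "t \<in> B1 \<union> B2 \<union> B3"
        using t center_cases[of t] by (cases "t < a") (auto simp: B1_def B2_def B3_def)
    qed
    then have "dis (\<lambda>t. y t - center t) d \<le> emeasure lborel (B1 \<union> B2 \<union> B3)"
      unfolding dis_def by (intro emeasure_mono) auto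
    also have "\<dots> \<le> emeasure lborel (B1 \<union> B2) + emeasure lborel B3"
      by (intro emeasure_subadditive) auto
    also have "\<dots> \<le> (emeasure lborel B1 + emeasure lborel B2) + emeasure lborel B3"
      by (intro add_right_mono emeasure_subadditive) auto
    \<comment> \<open>Four quarters: one each for \<open>B1\<close> and \<open>B2\<close>, and two
      for \<open>B3\<close>, bounded by \<open>k\<close> plus the measure of
      \<open>B1\<close>.\<close>
    also have "\<dots> \<le> (ennreal (\<theta> / 4) + ennreal (\<theta> / 4)) + (ennreal (\<theta> / 4) + ennreal (\<theta> / 4))"
      using k by (intro add_mono m1 m2 order_trans[OF m3] ennreal_leI) auto
    also have "\<dots> = ennreal \<theta>" using \<theta> by (simp flip: ennreal_plus)
    finally show "dis (\<lambda>t. y t - center t) d \<le> ennreal \<theta>" .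
  qed
qed

section \<open>The modular distance to the center, split by levels\<close>

lemma W_dis_diff_le:
  assumes [measurable]: "y \<in> borel_measurable borel" and "0 \<le> l"
  shows "W (dis (\<lambda>t. y t - center t) l) \<le> ennreal V + W (dis y l)"
proof -
  have "{t \<in> P. l < \<bar>y t - center t\<bar>} \<subseteq> {0<..<a} \<union> {t \<in> P. l < \<bar>y t\<bar>}"
    by (auto simp: center_def indicator_def P_def split: if_splits)
  then have "dis (\<lambda>t. y t - center t) l \<le> emeasure lborel ({0<..<a} \<union> {t \<in> P. l < \<bar>y t\<bar>})"
    unfolding dis_def using level_set_borel[of y] by (intro emeasure_mono) auto
  also have "\<dots> \<le> ennreal a + dis y l"
    unfolding dis_def emeasure_A[symmetric] using level_set_borel[of y] by (intro emeasure_subadditive) auto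
  finally have "W (dis (\<lambda>t. y t - center t) l) \<le> W (ennreal a + dis y l)" by (rule W_mono)
  also have "\<dots> \<le> ennreal V + W (dis y l)" using W_add_le[of "ennreal a" "dis y l"] W_a by simp
  finally show ?thesis .
qed

text \<open>At low levels the level sets of the difference may be large. Either \<open>W\<close> is
  bounded and a range of length \<open>d\<close> contributes little, or doubling near 0 compares the
  integral with the head of the modular of \<open>y\<close>.\<close>

lemma small_levels:
  assumes c: "0 < c" and alt: "\<gamma> < \<infinity> \<or> (\<exists>K. \<forall>l>0. psi (c * l) \<le> K * psi l)"
  obtains C where "0 \<le> C"
    "\<And>y e d. almost_norming y e \<Longrightarrow> 0 < d \<Longrightarrow> d \<le> u \<Longrightarrow>
      (\<integral>\<^sup>+l. W (dis (\<lambda>t. y t - center t) l) * Psi (c * l) * indicator {..<d} l \<partial>lborel) \<le> ennreal (C * (d + e))"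
  using alt
proof (elim disjE exE)
  assume "\<gamma> < \<infinity>"
  note W_bounded = W_bounded[OF this]
  define M where "M = enn2real (W \<infinity>)"
  have M: "W s \<le> ennreal M" "0 \<le> M" for s
    using W_bounded by (auto simp: M_def)
  show thesis
  proof (rule that[of "M * psi (c * u)"])
    show "0 \<le> M * psi (c * u)" using M by simp
    fix y e d assume y: "almost_norming y e" and d: "0 < d" "d \<le> u"
    have "(\<integral>\<^sup>+l. W (dis (\<lambda>t. y t - center t) l) * Psi (c * l) * indicator {..<d} l \<partial>lborel) \<le>
        (\<integral>\<^sup>+l. ennreal (M * psi (c * u)) * indicator {0..d} l \<partial>lborel)"
    proof (rule nn_integral_mono)
      fix l
      have "W (dis (\<lambda>t. y t - center t) l) * Psi (c * l) \<le> ennreal M * Psi (c * u)" if "0 < l" "l < d"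
        using that c d M by (intro mult_mono ennreal_leI psi_mono) auto
      moreover have "Psi (c * l) = 0" if "l \<le> 0" using that c by (simp add: mult_nonneg_nonpos)
      ultimately show "W (dis (\<lambda>t. y t - center t) l) * Psi (c * l) * indicator {..<d} l
          \<le> ennreal (M * psi (c * u)) * indicator {0..d} l"
        using M by (cases "0 < l"; cases "l < d") (auto simp: ennreal_mult)
    qed
    also have "\<dots> = ennreal (M * psi (c * u)) * ennreal d"
      using d by (simp add: nn_integral_cmult)
    also have "\<dots> = ennreal (M * psi (c * u) * d)"
      using d M by (simp flip: ennreal_mult)
    also have "\<dots> \<le> ennreal (M * psi (c * u) * (d + e))"
      using y M by (intro ennreal_leI mult_left_mono) (auto simp: almost_norming_def)
    finally show "(\<integral>\<^sup>+l. W (dis (\<lambda>t. y t - center t) l) * Psi (c * l) * indicator {..<d} l \<partial>lborel)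
        \<le> ennreal (M * psi (c * u) * (d + e))" .
  qed
next
  fix K assume K: "\<forall>l>0. psi (c * l) \<le> K * psi l"
  have "0 < K * psi 1" using K[rule_format, of 1] psi_pos[of c] c by simp
  then have K0: "0 < K" using psi_pos[of 1] by (simp add: zero_less_mult_iff)
  \<comment> \<open>One summand for the center, two for \<open>K\<close> times the bound of
    \<open>nn_integral_head_le\<close>.\<close>
  define C where "C = V * psi (c * u) + K + K * V * psi u"
  show thesis
  proof (rule that)
    show "0 \<le> C" using V_nonneg K0 by (simp add: C_def)
    fix y e d assume y: "almost_norming y e" and d: "0 < d" "d \<le> u"
    have [measurable]: "y \<in> borel_measurable borel" and e: "0 < e"
      using y by (auto simp: almost_norming_def)
    have "(\<integral>\<^sup>+l. W (dis (\<lambda>t. y t - center t) l) * Psi (c * l) * indicator {..<d} l \<partial>lborel) \<le>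
        (\<integral>\<^sup>+l. ennreal (V * psi (c * u)) * indicator {0..d} l +
          ennreal K * (W (dis y l) * Psi l * indicator {..<d} l) \<partial>lborel)"
    proof (rule nn_integral_mono)
      fix l
      show "W (dis (\<lambda>t. y t - center t) l) * Psi (c * l) * indicator {..<d} l
        \<le> ennreal (V * psi (c * u)) * indicator {0..d} l +
          ennreal K * (W (dis y l) * Psi l * indicator {..<d} l)"
      proof (cases "0 < l \<and> l < d")
        case True
        have "W (dis (\<lambda>t. y t - center t) l) * Psi (c * l) \<le> (ennreal V + W (dis y l)) * Psi (c * l)"
          using True by (intro mult_right_mono W_dis_diff_le) auto
        also have "\<dots> = ennreal V * Psi (c * l) + W (dis y l) * Psi (c * l)"
          by (rule distrib_right)
        also have "\<dots> \<le> ennreal V * Psi (c * u) + W (dis y l) * ennreal (K * psi l)"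
          using True K c d by (intro add_mono mult_left_mono ennreal_leI psi_mono) auto
        finally show ?thesis
          using True V_nonneg K0 by (simp add: ennreal_mult mult_ac)
      next
        case False
        moreover have "Psi (c * l) = 0" if "l \<le> 0" using that c by (simp add: mult_nonneg_nonpos)
        ultimately show ?thesis by (cases "l \<le> 0") auto
      qed
    qed
    also have "\<dots> = ennreal (V * psi (c * u)) * ennreal d +
        ennreal K * (\<integral>\<^sup>+l. W (dis y l) * Psi l * indicator {..<d} l \<partial>lborel)"
      using d by (simp add: nn_integral_add nn_integral_cmult)
    also have "\<dots> \<le> ennreal (V * psi (c * u)) * ennreal d + ennreal K * ennreal (e + V * psi u * d)"
      by (intro add_left_mono mult_left_mono nn_integral_head_le[OF y d]) auto
    also have "\<dots> = ennreal (V * psi (c * u) * d + K * (e + V * psi u * d))"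
      using d e V_nonneg K0 by (simp flip: ennreal_mult ennreal_plus)
    also have "\<dots> \<le> ennreal (C * (d + e))"
    proof (rule ennreal_leI)
      have "C * (d + e) = V * psi (c * u) * d + K * (e + V * psi u * d) +
          (V * psi (c * u) * e + K * d + K * V * psi u * e)"
        by (simp add: C_def algebra_simps)
      moreover have "0 \<le> V * psi (c * u) * e + K * d + K * V * psi u * e"
        using d e V_nonneg K0 by simp
      ultimately show "V * psi (c * u) * d + K * (e + V * psi u * d) \<le> C * (d + e)" by linarith
    qed
    finally show "(\<integral>\<^sup>+l. W (dis (\<lambda>t. y t - center t) l) * Psi (c * l) * indicator {..<d} l \<partial>lborel)
        \<le> ennreal (C * (d + e))" .
  qed
qed

text \<open>At levels \<open>l >= 2 * L\<close> the center is below \<open>l / 2\<close>, so a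
  difference above \<open>l\<close> forces \<open>y\<close> above \<open>l / 2\<close> in absolute
  value. Rescaling the levels by 2 then produces \<open>psi (2 * c * l)\<close>, whence the 2 in the
  hypothesis.\<close>

lemma large_levels:
  assumes c: "0 < c" and K: "\<And>l. l0 \<le> l \<Longrightarrow> psi (2 * c * l) \<le> K * psi l"
  obtains C L where "0 \<le> C" "u < L"
    "\<And>y e. almost_norming y e \<Longrightarrow>
      (\<integral>\<^sup>+l. W (dis (\<lambda>t. y t - center t) l) * Psi (c * l) * indicator {L..} l \<partial>lborel) \<le> ennreal (C * e)"
proof -
  define L where "L = max (u + 1) l0"
  have L: "u < L" "l0 \<le> L" "0 < L" using u_pos by (auto simp: L_def)
  have "0 < K * psi L" using K[OF L(2)] psi_pos[of "2 * c * L"] c L by auto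
  then have K0: "0 < K" using psi_pos[of L] L by (simp add: zero_less_mult_iff)
  define k where "k = 1 - p / psi L"
  have k: "0 < k" using above_u[OF L(1)] p_pos by (simp add: k_def)
  show thesis
  proof (rule that)
    show "0 \<le> 2 * K / k" "u < 2 * L" using K0 k L u_pos by auto
    fix y e assume y: "almost_norming y e"
    have [measurable]: "y \<in> borel_measurable borel" and e: "0 < e"
      using y by (auto simp: almost_norming_def)
    have "(\<integral>\<^sup>+l. W (dis (\<lambda>t. y t - center t) l) * Psi (c * l) * indicator {2 * L..} l \<partial>lborel) \<le>
        (\<integral>\<^sup>+l. W (dis y (l / 2)) * Psi (c * l) * indicator {2 * L..} l \<partial>lborel)"
    proof (rule nn_integral_mono)
      fix l
      have "dis (\<lambda>t. y t - center t) l \<le> dis y (l / 2)" if l: "2 * L \<le> l"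
      proof (rule dis_le)
        fix t assume "l < \<bar>y t - center t\<bar>"
        moreover have "0 \<le> center t" "center t \<le> u" using u_pos by (auto simp: center_def indicator_def)
        ultimately show "l / 2 < \<bar>y t\<bar>" using l L by linarith
      qed measurable
      then show "W (dis (\<lambda>t. y t - center t) l) * Psi (c * l) * indicator {2 * L..} l
          \<le> W (dis y (l / 2)) * Psi (c * l) * indicator {2 * L..} l"
        by (cases "2 * L \<le> l") (auto intro!: mult_right_mono W_mono)
    qed
    also have "\<dots> = ennreal \<bar>2\<bar> * (\<integral>\<^sup>+l. W (dis y ((0 + 2 * l) / 2)) * Psi (c * (0 + 2 * l)) *
        indicator {2 * L..} (0 + 2 * l) \<partial>lborel)"
      by (rule nn_integral_real_affine) auto
    also have "\<dots> \<le> ennreal 2 * (\<integral>\<^sup>+l. ennreal K * (W (dis y l) * Psi l * indicator {L..} l) \<partial>lborel)"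
    proof (simp, intro mult_left_mono nn_integral_mono)
      fix l
      have "Psi (c * (2 * l)) \<le> ennreal K * Psi l" if "L \<le> l"
        using K[of l] that L K0 by (auto simp: mult_ac simp flip: ennreal_mult intro!: ennreal_leI)
      then have "W (dis y l) * Psi (c * (2 * l)) \<le> W (dis y l) * (ennreal K * Psi l)" if "L \<le> l"
        using that by (intro mult_left_mono) auto
      then show "W (dis y l) * Psi (c * (2 * l)) * indicator {2 * L..} (2 * l) \<le>
          ennreal K * (W (dis y l) * Psi l * indicator {L..} l)"
        by (cases "L \<le> l") (auto simp: mult_ac)
    qed simp
    also have "\<dots> = ennreal 2 * (ennreal K * (\<integral>\<^sup>+l. W (dis y l) * Psi l * indicator {L..} l \<partial>lborel))"
      by (subst nn_integral_cmult) auto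
    also have "\<dots> \<le> ennreal 2 * (ennreal K * ennreal (e / k))"
      unfolding k_def by (intro mult_left_mono nn_integral_tail_le[OF y L(1)]) auto
    also have "\<dots> = ennreal (2 * (K * (e / k)))"
      using K0 k e by (simp only: ennreal_mult zero_le_numeral less_imp_le mult_nonneg_nonneg divide_nonneg_nonneg)
    also have "2 * (K * (e / k)) = 2 * K / k * e" by simp
    finally show "(\<integral>\<^sup>+l. W (dis (\<lambda>t. y t - center t) l) * Psi (c * l) * indicator {2 * L..} l \<partial>lborel)
        \<le> ennreal (2 * K / k * e)" .
  qed
qed

text \<open>Only the levels between \<open>d\<close> and \<open>L\<close> use closeness in measure.
  \<open>e\<close> is fixed last, since the admissible defect depends on \<open>d\<close> and
  \<theta>. Each of the three ranges gets at most 1/8 of the modular, the low one as 1/16 for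
  \<open>d\<close> and 1/16 for \<open>e\<close>.\<close>

lemma almost_norming_imp_close:
  assumes c: "0 < c" and alt: "\<gamma> < \<infinity> \<or> (\<exists>K. \<forall>l>0. psi (c * l) \<le> K * psi l)"
    and K: "\<And>l. l0 \<le> l \<Longrightarrow> psi (2 * c * l) \<le> K * psi l"
  obtains e where "0 < e"
    "\<And>y. almost_norming y e \<Longrightarrow> rho (\<lambda>t. c * (y t - center t)) \<le> ennreal (1 / 2)"
proof -
  obtain C1 where C1: "0 \<le> C1" and small: "\<And>y e d. almost_norming y e \<Longrightarrow> 0 < d \<Longrightarrow> d \<le> u \<Longrightarrow>
      (\<integral>\<^sup>+l. W (dis (\<lambda>t. y t - center t) l) * Psi (c * l) * indicator {..<d} l \<partial>lborel) \<le> ennreal (C1 * (d + e))"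
    by (atomize_elim, rule small_levels[OF c alt]) blast
  obtain C3 L where C3: "0 \<le> C3" and L: "u < L" and large: "\<And>y e. almost_norming y e \<Longrightarrow>
      (\<integral>\<^sup>+l. W (dis (\<lambda>t. y t - center t) l) * Psi (c * l) * indicator {L..} l \<partial>lborel) \<le> ennreal (C3 * e)"
    by (atomize_elim, rule large_levels[OF c K]) blast+
  \<comment> \<open>Bounds the integral of \<open>psi (c * l)\<close> over the middle range.\<close>
  define C2 where "C2 = L * psi (c * L)"
  have C2: "0 \<le> C2" using L u_pos by (simp add: C2_def)
  define d where "d = min (u / 4) (1 / (16 * c * (C1 + 1)))"
  have d: "0 < d" "2 * d < u" "d \<le> u" using u_pos c C1 by (auto simp: d_def)
  have cd: "c * (C1 * d) \<le> 1 / 16"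
    using c C1 d by (intro mult_le_if_le_divide) (auto simp: d_def)
  define r where "r = 1 / (8 * c * (C2 + 1))"
  have "0 < r" using c C2 by (simp add: r_def)
  moreover have "c * (C2 * r) \<le> 1 / 8"
    using c C2 calculation by (intro mult_le_if_le_divide) (auto simp: r_def)
  ultimately have r: "0 < r" "c * (r * C2) \<le> 1 / 8" by (auto simp: mult.commute)
  obtain \<theta> where \<theta>: "0 < \<theta>" "W (ennreal \<theta>) < ennreal r"
    using W_small[of "ennreal r"] r by auto
  obtain e0 where e0: "0 < e0" and mass: "\<And>y e. almost_norming y e \<Longrightarrow> e \<le> e0 \<Longrightarrow>
      dis (\<lambda>t. y t - center t) d \<le> ennreal \<theta>"
    by (atomize_elim, rule center_in_measure[OF d(1,2) \<theta>(1)]) blast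
  define e where "e = Min {e0, 1 / (16 * c * (C1 + 1)), 1 / (8 * c * (C3 + 1))}"
  have e: "0 < e" "e \<le> e0" using e0 c C1 C3 by (auto simp: e_def)
  have ce1: "c * (C1 * e) \<le> 1 / 16"
    using c C1 e by (intro mult_le_if_le_divide) (auto simp: e_def)
  have ce3: "c * (C3 * e) \<le> 1 / 8"
    using c C3 e by (intro mult_le_if_le_divide) (auto simp: e_def)
  show thesis
  proof (rule that[OF e(1)])
    fix y assume y: "almost_norming y e"
    have [measurable]: "y \<in> borel_measurable borel" using y by (simp add: almost_norming_def)
    let ?z = "\<lambda>t. y t - center t"
    let ?f = "\<lambda>l. W (dis ?z l) * Psi (c * l)"
    have middle: "(\<integral>\<^sup>+l. ?f l * indicator {d..<L} l \<partial>lborel) \<le> ennreal (r * C2)"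
    proof -
      have "(\<integral>\<^sup>+l. ?f l * indicator {d..<L} l \<partial>lborel) \<le>
          (\<integral>\<^sup>+l. ennreal (r * psi (c * L)) * indicator {0..L} l \<partial>lborel)"
      proof (rule nn_integral_mono)
        fix l
        have "?f l \<le> ennreal r * Psi (c * L)" if "d \<le> l" "l < L"
        proof (intro mult_mono ennreal_leI psi_mono)
          have "W (dis ?z l) \<le> W (dis ?z d)"
            using that by (intro W_mono antimonoD[OF dis_antimono]) auto
          also have "\<dots> \<le> W (ennreal \<theta>)" by (rule W_mono[OF mass[OF y e(2)]])
          finally show "W (dis ?z l) \<le> ennreal r" using \<theta> by simp
        qed (use that c d in auto)
        then show "?f l * indicator {d..<L} l \<le> ennreal (r * psi (c * L)) * indicator {0..L} l"
          using d r by (cases "d \<le> l \<and> l < L") (auto simp: ennreal_mult)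
      qed
      also have "\<dots> = ennreal (r * psi (c * L)) * ennreal L"
        using L u_pos by (simp add: nn_integral_cmult)
      also have "\<dots> = ennreal (r * C2)"
        using r L u_pos by (simp add: C2_def mult_ac flip: ennreal_mult)
      finally show ?thesis .
    qed
    have "rho (\<lambda>t. c * ?z t) = ennreal c * (\<integral>\<^sup>+l. ?f l \<partial>lborel)"
      using c by (intro rho_scale) auto
    also have "(\<integral>\<^sup>+l. ?f l \<partial>lborel) =
        (\<integral>\<^sup>+l. ?f l * indicator {..<d} l + ?f l * indicator {d..<L} l + ?f l * indicator {L..} l \<partial>lborel)"
      using d L by (intro nn_integral_cong) (auto simp: indicator_def)
    also have "\<dots> = (\<integral>\<^sup>+l. ?f l * indicator {..<d} l \<partial>lborel) +
        (\<integral>\<^sup>+l. ?f l * indicator {d..<L} l \<partial>lborel) + (\<integral>\<^sup>+l. ?f l * indicator {L..} l \<partial>lborel)"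
      by (simp add: nn_integral_add)
    also have "ennreal c * \<dots> \<le> ennreal c * (ennreal (C1 * (d + e)) + ennreal (r * C2) + ennreal (C3 * e))"
      by (intro mult_left_mono add_mono middle small[OF y d(1,3)] large[OF y]) auto
    also have "\<dots> = ennreal (c * (C1 * (d + e) + r * C2 + C3 * e))"
      using c C1 C2 C3 d e r by (simp flip: ennreal_mult ennreal_plus)
    also have "\<dots> \<le> ennreal (1 / 2)"
      using cd ce1 ce3 r by (intro ennreal_leI) (simp add: algebra_simps)
    finally show "rho (\<lambda>t. c * ?z t) \<le> ennreal (1 / 2)" .
  qed
qed

end

section \<open>Small slices\<close>

text \<open>Doubling passes from \<phi> to \<open>psi\<close> because \<open>psi t\<close> lies
  between \<open>\<phi> t / t\<close> and \<open>\<phi> (2 * t) / t\<close>; \<open>n\<close>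
  doublings with \<open>2 ^ n > 2 * c\<close> cover the dilation.\<close>

lemma (in orlicz) psi_dilation:
  assumes K: "0 < K" and doubling: "\<And>v. v0 \<le> v \<Longrightarrow> \<phi> (2 * v) \<le> K * \<phi> v" and "0 \<le> v0" and c: "0 < c"
  obtains C where "\<And>l. 0 < l \<Longrightarrow> v0 \<le> l \<Longrightarrow> psi (c * l) \<le> C * psi l"
proof -
  have iter: "\<phi> (2 ^ n * v) \<le> K ^ n * \<phi> v" if "v0 \<le> v" for n v
  proof (induction n)
    case (Suc n)
    have "v * 1 \<le> v * 2 ^ n" using that \<open>0 \<le> v0\<close> by (intro mult_left_mono) auto
    then have "\<phi> (2 * (2 ^ n * v)) \<le> K * \<phi> (2 ^ n * v)"
      using that by (intro doubling) (simp add: mult.commute)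
    also have "\<dots> \<le> K * (K ^ n * \<phi> v)" using Suc K by (intro mult_left_mono) auto
    finally show ?case by (simp add: mult.assoc)
  qed simp
  obtain n where n: "2 * c < 2 ^ n" using real_arch_pow[of 2 "2 * c"] by auto
  show thesis
  proof (rule that)
    fix l assume l: "0 < l" "v0 \<le> l"
    have "psi (c * l) \<le> \<phi> (2 * (c * l)) / (c * l)" using l c by (intro psi_le_phi_double) simp
    also have "\<dots> \<le> \<phi> (2 ^ n * l) / (c * l)"
    proof -
      have "2 * c * l \<le> 2 ^ n * l" using n l by (intro mult_right_mono) auto
      then have "\<phi> (2 * (c * l)) \<le> \<phi> (2 ^ n * l)" using l c by (intro phi_mono) (auto simp: mult.assoc)
      then show ?thesis using l c by (simp add: divide_right_mono)
    qed
    also have "\<dots> \<le> K ^ n * \<phi> l / (c * l)"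
      using iter[OF l(2), of n] l c by (simp add: divide_right_mono)
    also have "\<dots> \<le> K ^ n * (psi l * l) / (c * l)"
      using phi_over_le_psi[OF l(1)] l c K
      by (intro divide_right_mono mult_left_mono) (auto simp: pos_divide_le_eq)
    also have "\<dots> = K ^ n / c * psi l" using l c by simp
    finally show "psi (c * l) \<le> K ^ n / c * psi l" .
  qed
qed

context exposed
begin

text \<open>At levels strictly between 0 and \<open>u\<close> the level set of the center is exactly
  (0,a), so its modular is \<open>V * \<phi> u = 1\<close>. This makes the slice nonempty.\<close>

lemma center_in_space:
  defines "X \<equiv> abs_lebfun center"
  shows "X \<in> OL_ball \<gamma> \<phi> w" "pairing a X = u * V"
proof -
  have brepX: "AE t in lborel. brep X t = center t"
    unfolding X_def by (intro brep_abs borel_imp_lebesgue) measurable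
  have "rho (brep X) = rho center"
    by (intro rho_cong_AE brepX) measurable
  also have "\<dots> = (\<integral>\<^sup>+l. ennreal V * (Psi l * indicator {..<u} l) \<partial>lborel)"
    unfolding rho_def
  proof (rule nn_integral_cong)
    fix l
    show "W (dis center l) * Psi l = ennreal V * (Psi l * indicator {..<u} l)"
    proof (cases "0 < l")
      case True
      have "{t \<in> P. l < \<bar>center t\<bar>} = (if l < u then {0<..<a} else {})"
        using True u_pos P_downward[OF a_in_P] by (auto simp: center_def indicator_def split: if_splits)
      then have "dis center l = (if l < u then ennreal a else 0)"
        by (simp add: dis_def emeasure_A del: emeasure_lborel_Ioo)
      then show ?thesis using W_a by simp
    qed simp
  qed
  also have "\<dots> = ennreal V * ennreal (\<phi> u)"
    using u_pos by (simp add: nn_integral_cmult nn_integral_psi_lessThan)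
  also have "\<dots> = 1" using normalised V_nonneg by (simp flip: ennreal_mult')
  finally have rhoX: "rho (brep X) = 1" .
  have "vanishes_off (interval \<gamma>) X"
    unfolding X_def
  proof (subst vanishes_off.abs_eq)
    show "center \<in> borel_measurable lebesgue \<and> center \<in> borel_measurable lebesgue \<and>
        (AE t in lebesgue. center t = center t)"
      by (auto intro: borel_imp_lebesgue)
    show "AE t in lebesgue. t \<notin> interval \<gamma> \<longrightarrow> center t = 0"
    proof (intro AE_I2 impI)
      fix t assume "t \<notin> interval \<gamma>"
      then have "t \<notin> {0<..<a}" using P_downward[OF a_in_P, of t] P_subset_interval by auto
      then show "center t = 0" by (simp add: center_def)
    qed
  qed
  moreover have "OL_modular \<gamma> \<phi> w (1 *\<^sub>R X) < \<infinity>"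
    using rhoX by (simp add: OL_modular_eq_rho)
  ultimately have "X \<in> OL_space \<gamma> \<phi> w"
    unfolding OL_space_def L0_def by (auto intro: exI[of _ 1])
  moreover have "OL_norm \<gamma> \<phi> w X \<le> 1"
    using rhoX by (intro OL_norm_le) auto
  ultimately show "X \<in> OL_ball \<gamma> \<phi> w" by (simp add: OL_ball_def)
  have "pairing a X = (\<integral>t. u * indicator {0<..<a} t \<partial>nu)"
    unfolding pairing_def using AE_nu[OF brepX]
    by (intro integral_cong_AE) (auto simp: center_def indicator_def elim!: eventually_mono)
  also have "\<dots> = u * V"
    using nu_A V_nonneg by (simp add: measure_def)
  finally show "pairing a X = u * V" .
qed

text \<open>Passing to the positive part only raises the pairing, and the layer cake turns it into
  the integral of \<open>h\<close>. The slack \<open>e / p\<close> becomes \<open>e\<close> after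
  multiplication by \<open>p\<close>.\<close>

lemma almost_norming_brep:
  assumes X: "X \<in> OL_ball \<gamma> \<phi> w" and e: "0 < e" and large: "u * V - e / p < pairing a X"
  shows "almost_norming (brep X) e"
proof -
  have space: "X \<in> OL_space \<gamma> \<phi> w" and norm: "OL_norm \<gamma> \<phi> w X \<le> 1"
    using X by (auto simp: OL_ball_def)
  define H where "H = (\<integral>\<^sup>+l. h (brep X) l * indicator {0<..} l \<partial>lborel)"
  let ?g = "\<lambda>t. max 0 (brep X t * indicator {0<..<a} t)"
  have int: "integrable nu (\<lambda>t. brep X t * indicator {0<..<a} t)"
    by (rule pairing_integrable(1)[OF a_in_P a_pos space])
  then have int': "integrable nu ?g" by (intro integrable_max) auto
  have "pairing a X \<le> (\<integral>t. ?g t \<partial>nu)"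
    unfolding pairing_def by (intro integral_mono int int') auto
  then have "ennreal (pairing a X) \<le> ennreal (\<integral>t. ?g t \<partial>nu)" by (rule ennreal_leI)
  also have "\<dots> = (\<integral>\<^sup>+t. ennreal (?g t) \<partial>nu)"
    by (rule nn_integral_eq_integral[symmetric, OF int']) auto
  also have "\<dots> = (\<integral>\<^sup>+t. ennreal (brep X t) * indicator {0<..<a} t \<partial>nu)"
    by (intro nn_integral_cong) (auto simp: indicator_def max_def ennreal_neg)
  also have "\<dots> = H"
    unfolding H_def h_def by (rule nn_integral_level_sets) measurable
  finally have "ennreal (pairing a X) \<le> H" .
  have "ennreal (p * (u * V)) \<le> ennreal (p * max 0 (pairing a X) + e)"
  proof (rule ennreal_leI)
    have "p * (u * V) - e < p * pairing a X"
      using mult_strict_left_mono[OF large p_pos] p_pos by (simp add: right_diff_distrib)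
    also have "\<dots> \<le> p * max 0 (pairing a X)" using p_pos by (intro mult_left_mono) auto
    finally show "p * (u * V) \<le> p * max 0 (pairing a X) + e" by simp
  qed
  also have "\<dots> = ennreal p * ennreal (pairing a X) + ennreal e"
    using p_pos e by (cases "0 \<le> pairing a X") (auto simp: ennreal_mult ennreal_neg)
  also have "\<dots> \<le> ennreal p * H + ennreal e"
    using \<open>ennreal (pairing a X) \<le> H\<close> by (intro add_right_mono mult_left_mono) auto
  finally show ?thesis
    using e rho_le_1_if_norm_le_1[OF space norm] by (simp add: almost_norming_def H_def)
qed

text \<open>Two elements of the slice are compared through the center: \<open>rho_add_le\<close>
  doubles the scale \<open>1 / r\<close> to \<open>2 / r\<close>, and the two halves add up to
  1.\<close>

lemma small_weakly_open_set:
  assumes r: "0 < r" and e: "0 < e" and close: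
    "\<And>y. almost_norming y e \<Longrightarrow> rho (\<lambda>t. 2 / r * (y t - center t)) \<le> ennreal (1 / 2)"
  shows "\<exists>U. openin (subtopology (weak_topology_on (OL_space \<gamma> \<phi> w) (OL_norm \<gamma> \<phi> w)) (OL_ball \<gamma> \<phi> w)) U \<and>
    U \<noteq> {} \<and> norm_diam (OL_norm \<gamma> \<phi> w) U \<le> ereal r"
proof -
  let ?S = "OL_space \<gamma> \<phi> w" and ?N = "OL_norm \<gamma> \<phi> w"
  define T where "T = {X \<in> ?S. pairing a X \<in> {u * V - e / p<..}}"
  define U where "U = T \<inter> OL_ball \<gamma> \<phi> w"
  have "openin (weak_topology_on ?S ?N) T"
    unfolding weak_topology_on_def
  proof (rule topology_generated_by_Basis)
    show "T \<in> {{x \<in> ?S. f x \<in> V} |f V. f \<in> dual_on ?S ?N \<and> open V}"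
      unfolding T_def using pairing_dual[OF a_in_P a_pos] open_greaterThan by blast
  qed
  then have "openin (subtopology (weak_topology_on ?S ?N) (OL_ball \<gamma> \<phi> w)) U"
    unfolding U_def openin_subtopology by blast
  moreover have "abs_lebfun center \<in> U"
    using center_in_space e p_pos by (auto simp: U_def T_def OL_ball_def)
  moreover have "norm_diam ?N U \<le> ereal r"
    unfolding norm_diam_def
  proof (rule SUP_least, clarify)
    fix X Y assume XY: "X \<in> U" "Y \<in> U"
    have close': "rho (\<lambda>t. 2 / r * (brep Z t - center t)) \<le> ennreal (1 / 2)" if "Z \<in> U" for Z
      using that e by (intro close almost_norming_brep) (auto simp: U_def T_def)
    have "rho (\<lambda>t. brep (X - Y) t / r) =
        rho (\<lambda>t. 1 / r * (brep X t - center t) + 1 / r * (center t - brep Y t))"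
      using brep_diff[of X Y]
      by (intro rho_cong_AE) (auto elim!: eventually_mono simp: diff_divide_distrib)
    also have "\<dots> \<le> rho (\<lambda>t. 2 * (1 / r * (brep X t - center t))) +
        rho (\<lambda>t. 2 * (1 / r * (center t - brep Y t)))"
      by (intro rho_add_le) measurable
    also have "rho (\<lambda>t. 2 * (1 / r * (center t - brep Y t))) = rho (\<lambda>t. 2 / r * (brep Y t - center t))"
      unfolding rho_def dis_def by (simp add: abs_mult abs_minus_commute)
    also have "rho (\<lambda>t. 2 * (1 / r * (brep X t - center t))) = rho (\<lambda>t. 2 / r * (brep X t - center t))"
      by simp
    also have "rho (\<lambda>t. 2 / r * (brep X t - center t)) + rho (\<lambda>t. 2 / r * (brep Y t - center t))
        \<le> ennreal (1 / 2) + ennreal (1 / 2)"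
      by (intro add_mono close' XY)
    also have "\<dots> = 1" by (subst ennreal_plus[symmetric]) auto
    finally show "ereal (?N (X - Y)) \<le> ereal r"
      using OL_norm_le[OF r] by simp
  qed
  ultimately show ?thesis by blast
qed

end

theorem corollary2p4:
  fixes \<gamma> :: ereal and w \<phi> :: "real \<Rightarrow> real"
  assumes "0 < \<gamma>"
    and "weight \<gamma> w"
    and "\<gamma> = \<infinity> \<Longrightarrow> (\<integral>\<^sup>+ t \<in> {0..}. ennreal (w t) \<partial>lebesgue) = \<infinity>"
    and "orlicz_N_fun \<phi>"
    and "\<gamma> = \<infinity> \<Longrightarrow> Delta2 \<phi>"
    and "\<gamma> < \<infinity> \<Longrightarrow> Delta2_infty \<phi>"
  shows "\<forall>\<epsilon>>0::real. \<exists>U.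
           openin (subtopology (weak_topology_on (OL_space \<gamma> \<phi> w) (OL_norm \<gamma> \<phi> w))
                     (OL_ball \<gamma> \<phi> w)) U \<and>
           U \<noteq> {} \<and> norm_diam (OL_norm \<gamma> \<phi> w) U < ereal \<epsilon>"
proof (intro allI impI)
  fix \<epsilon> :: real assume \<epsilon>: "0 < \<epsilon>"
  interpret orlicz_lorentz \<gamma> w \<phi>
    using assms(1,2,4) by unfold_locales (auto simp: orlicz_N_fun_def)
  have growth: "filterlim (\<lambda>u. \<phi> u / u) at_top at_top"
    using assms(4) by (simp add: orlicz_N_fun_def)
  obtain t where t: "0 < t" "t \<in> P" by (rule exists_in_P)
  define V0 where "V0 = enn2real (W (ennreal t))"
  have V0: "W (ennreal t) = ennreal V0" "0 < V0"
    using W_finite[OF t(2)] W_pos[of "ennreal t"] t by (auto simp: V0_def enn2real_positive_iff)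
  \<comment> \<open>Beyond this bound the supporting line of \<phi> at 1 gives
    \<open>\<phi> u > 1 / V0\<close>, so that \<open>1 / \<phi> u\<close> is below
    \<open>W (ennreal t)\<close> and \<open>W_surj\<close> applies.\<close>
  obtain u p where u: "1 + 1 / (V0 * psi 1) < u" "0 < u" "0 < p"
    and below: "\<And>l. l < u \<Longrightarrow> psi l < p" and above: "\<And>l. u < l \<Longrightarrow> p < psi l"
    using exposed_point_exists[OF growth, of "1 + 1 / (V0 * psi 1)"] by blast
  have psi1: "0 < psi 1" by (simp add: psi_pos)
  have "1 / V0 < \<phi> u"
  proof -
    have "0 < 1 / (V0 * psi 1)" using V0 psi1 by simp
    then have "1 < u" using u by linarith
    have "1 / V0 = psi 1 * (1 / (V0 * psi 1))" using psi1 by simp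
    also have "\<dots> < psi 1 * (u - 1)" using u psi1 by (intro mult_strict_left_mono) auto
    also have "\<dots> \<le> \<phi> u" using psi_diff_bounds(1)[of 1 u] \<open>1 < u\<close> phi_nonneg[of 1] by simp
    finally show ?thesis .
  qed
  moreover have phi_u: "0 < \<phi> u" using u by (simp add: phi_pos)
  ultimately have "1 / \<phi> u < V0" using V0 by (simp add: field_simps)
  then obtain a where a: "0 < a" "a \<in> P" "W (ennreal a) = ennreal (1 / \<phi> u)"
    using W_surj[OF t(2), of "1 / \<phi> u"] V0 phi_u by (auto simp: ennreal_less_iff)
  interpret exposed \<gamma> w \<phi> u p a "1 / \<phi> u"
    using u below above a phi_u by unfold_locales auto
  \<comment> \<open>Half of \<epsilon> leaves room for the strict inequality.\<close>
  define r where "r = \<epsilon> / 2"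
  have r: "0 < r" "0 < 2 / r" using \<epsilon> by (auto simp: r_def)
  have alt: "\<gamma> < \<infinity> \<or> (\<exists>K. \<forall>l>0. psi (2 / r * l) \<le> K * psi l)"
  proof (cases "\<gamma> = \<infinity>")
    case True
    then obtain K where K: "0 < K" "\<And>v. 0 \<le> v \<Longrightarrow> \<phi> (2 * v) \<le> K * \<phi> v"
      using assms(5) by (auto simp: Delta2_def)
    obtain C where "\<And>l. 0 < l \<Longrightarrow> 0 \<le> l \<Longrightarrow> psi (2 / r * l) \<le> C * psi l"
      using psi_dilation[OF K order_refl r(2)] by blast
    then show ?thesis by auto
  qed auto
  have "Delta2_infty \<phi>"
  proof (cases "\<gamma> = \<infinity>")
    case True
    then show ?thesis
      using assms(5) by (auto simp: Delta2_def Delta2_infty_def)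
  qed (use assms(6) in auto)
  then obtain K v0 where K: "0 < K" "0 \<le> v0" "\<And>v. v0 \<le> v \<Longrightarrow> \<phi> (2 * v) \<le> K * \<phi> v"
    by (auto simp: Delta2_infty_def)
  \<comment> \<open>The high levels need the dilation by twice the scale \<open>2 / r\<close>, as
    \<open>large_levels\<close> shows.\<close>
  have "0 < 2 * (2 / r)" using r by simp
  from psi_dilation[OF K(1,3,2) this]
  obtain C where C: "\<And>l. 0 < l \<Longrightarrow> v0 \<le> l \<Longrightarrow> psi (2 * (2 / r) * l) \<le> C * psi l" by blast
  have "psi (2 * (2 / r) * l) \<le> C * psi l" if "max 1 v0 \<le> l" for l
    using that by (intro C) auto
  from almost_norming_imp_close[OF r(2) alt this]
  obtain e where e: "0 < e" and close:
    "\<And>y. almost_norming y e \<Longrightarrow> rho (\<lambda>t. 2 / r * (y t - center t)) \<le> ennreal (1 / 2)" by blast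
  have "ereal r < ereal \<epsilon>" using \<epsilon> by (simp add: r_def)
  with small_weakly_open_set[OF r(1) e close]
  show "\<exists>U. openin (subtopology (weak_topology_on (OL_space \<gamma> \<phi> w) (OL_norm \<gamma> \<phi> w))
      (OL_ball \<gamma> \<phi> w)) U \<and> U \<noteq> {} \<and> norm_diam (OL_norm \<gamma> \<phi> w) U < ereal \<epsilon>"
    by (meson le_less_trans)
qed

end
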